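(* Let $(X,S)$ be a subshift. The following are equivalent. (1) $(X,S)$ is a Toeplitz subshift. (2) $(X,S)$ is generated by a constant length, primitive, proper and recognizable directive sequence. (3) $(X,S)$ is generated by a constant length, primitive and recognizable directive sequence with coincidences.
   Context: **Toeplitz subshifts.** Alphabets are finite nonempty sets; $S$ is the shift $(Sx)_n=x_{n+1}$ on $\mathcal A^{\mathbb Z}$; a subshift is a nonempty closed $S$-invariant subset of $\mathcal A^{\mathbb Z}$. For $x\in\mathcal A^{\mathbb Z}$ and $p\ge 1$, $\operatorname{Per}_p(x)$ is the set of $n\in\mathbb Z$ such that $(x_{n+kp})_{k\in\mathbb Z}$ is constant. A Toeplitz sequence is a non-periodic $x$ with $\bigcup_{p\ge 1}\operatorname{Per}_p(x)=\mathbb Z$. A Toeplitz subshift is the shift orbit closure of a Toeplitz sequence. **Directive sequences.** A directive sequence is a sequence $\boldsymbol{\tau}=(\tau_n:\mathcal A_{n+1}^*\to\mathcal A_n^* )_{n\ge 0}$ of nonerasing morphisms of free monoids (no letter is mapped to the empty word). For $n<N$, $\tau_{[n,N)}=\tau_n\circ\cdots\circ\tau_{N-1}$; $\tau_{[n,n)}$ is the identity. A morphism $\sigma$ has constant length if the length of $\sigma(a)$ does not depend on the letter $a$; this length is $|\sigma|$. $\boldsymbol{\tau}$ has constant length if every $\tau_n$, $n\ge 0$, does. A morphism $\sigma:\mathcal A^*\to\mathcal B^*$ is proper if there are $p,s\in\mathcal B$ such that $\sigma(a)$ starts with $p$ and ends with $s$ for every $a\in\mathcal A$; $\boldsymbol{\tau}$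 is proper if $\tau_n$ is proper for all $n\ge 1$. $\boldsymbol{\tau}$ is primitive if for every $n$ there is $N>n$ such that every letter of $\mathcal A_n$ occurs in $\tau_{[n,N)}(a)$ for every $a\in\mathcal A_N$. Let $\mathcal L^{(n)}(\boldsymbol{\tau})$ be the set of words over $\mathcal A_n$ occurring in $\tau_{[n,N)}(a)$ for some $N>n$, $a\in\mathcal A_N$; $X^{(n)}_{\boldsymbol{\tau}}$ is the set of $y\in\mathcal A_n^{\mathbb Z}$ all of whose finite factors are in $\mathcal L^{(n)}(\boldsymbol{\tau})$; $X_{\boldsymbol{\tau}}=X^{(0)}_{\boldsymbol{\tau}}$. $(X,S)$ is generated by $\boldsymbol{\tau}$ if $X=X_{\boldsymbol{\tau}}$. Morphisms act on bi-infinite sequences by concatenation, the image of the nonnegative coordinates starting at coordinate $0$. For $a\in\mathcal A_n$, $[a]=\{y\in X^{(n)}_{\boldsymbol{\tau}}:y_0=a\}$. $\boldsymbol{\tau}$ is recognizable if for every $n\ge 0$ the family of sets $S^k\tau_{[0,n)}([a])$, $a\in\mathcal A_n$, $0\le k<|\tau_{[0,n)}(a)|$, is a partition of $X_{\boldsymbol{\tau}}$ (sets with distinct indices are disjoint). A contraction of $\boldsymbol{\tau}$ is a directive sequence $(\tau'_k=\tau_{[n_k,n_{k+1})})_{k\ge 0}$ with $0=n_0<n_1<\cdots$. **Coincidences.** For a constant length morphism $\sigma:\mathcal A^*\to\mathcal B^*$, $\mathrm{coinc}(\sigma)$ is the set of $i\in\{0,\dots,|\sigma|-1\}$ such that the $i$-th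 letter (indexing from 0) of $\sigma(a)$ is the same for all $a\in\mathcal A$. A constant length $\boldsymbol{\tau}$ has coincidences if some contraction $(\tau'_k)_{k\ge 0}$ satisfies $\mathrm{coinc}(\tau'_k)\neq\emptyset$ for all $k\ge 0$. *)

theory Defs
  imports
    "HOL-Analysis.Function_Topology"
    "HOL-Library.Disjoint_Sets"
    "HOL-Library.Sublist"
    "HOL-Library.Infinite_Typeclass"
begin

section \<open>Subshifts and Toeplitz subshifts\<close>

definition alphabet :: "'a set \<Rightarrow> bool" where
  "alphabet A \<longleftrightarrow> finite A \<and> A \<noteq> {}"

definition full_shift :: "'a set \<Rightarrow> (int \<Rightarrow> 'a) topology" where
  "full_shift A = product_topology (\<lambda>_. discrete_topology A) UNIV"

definition shift :: "(int \<Rightarrow> 'a) \<Rightarrow> (int \<Rightarrow> 'a)" where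
  "shift x = (\<lambda>n. x (n + 1))"

text \<open>Closedness in \<^term>\<open>full_shift A\<close> includes that all points take values in \<^term>\<open>A\<close>.
  The shift is invertible, and invariance means \<open>S X = X\<close>.\<close>

definition subshift :: "'a set \<Rightarrow> (int \<Rightarrow> 'a) set \<Rightarrow> bool" where
  "subshift A X \<longleftrightarrow> X \<noteq> {} \<and> closedin (full_shift A) X \<and> shift ` X = X"

definition Per :: "nat \<Rightarrow> (int \<Rightarrow> 'a) \<Rightarrow> int set" where
  "Per p x = {n. (\<lambda>k::int. x (n + k * int p)) constant_on UNIV}"

definition periodic :: "(int \<Rightarrow> 'a) \<Rightarrow> bool" where
  "periodic x \<longleftrightarrow> (\<exists>p\<ge>1. (shift ^^ p) x = x)"

definition toeplitz_sequence :: "'a set \<Rightarrow> (int \<Rightarrow> 'a) \<Rightarrow> bool" where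
  "toeplitz_sequence A x \<longleftrightarrow>
     range x \<subseteq> A \<and> \<not> periodic x \<and> (\<Union>p\<in>{1..}. Per p x) = UNIV"

definition orbit :: "(int \<Rightarrow> 'a) \<Rightarrow> (int \<Rightarrow> 'a) set" where
  "orbit x = range (\<lambda>k n. x (n + k))"

definition toeplitz_subshift :: "'a set \<Rightarrow> (int \<Rightarrow> 'a) set \<Rightarrow> bool" where
  "toeplitz_subshift A X \<longleftrightarrow>
     (\<exists>x. toeplitz_sequence A x \<and> X = full_shift A closure_of orbit x)"


section \<open>Morphisms\<close>

text \<open>A morphism \<open>A\<^sup>* \<rightarrow> B\<^sup>*\<close> of free monoids is given by its values on the letters of \<open>A\<close>;
  its values on letters outside \<open>A\<close> are irrelevant.  Its extension to words is \<open>ext_word\<close>.\<close>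

type_synonym 'a morphism = "'a \<Rightarrow> 'a list"

definition ext_word :: "'a morphism \<Rightarrow> 'a list \<Rightarrow> 'a list" where
  "ext_word \<sigma> w = concat (map \<sigma> w)"

text \<open>The image of a bi-infinite sequence under a nonerasing morphism: the coordinates \<open>n \<ge> 0\<close> are
  those of \<open>\<sigma>(y\<^sub>0) \<sigma>(y\<^sub>1) \<dots>\<close> and the coordinates \<open>n < 0\<close> are those of \<open>\<dots> \<sigma>(y\<^sub>-\<^sub>2) \<sigma>(y\<^sub>-\<^sub>1)\<close>,
  read from the right.  As \<open>\<sigma>\<close> is nonerasing, the words \<open>\<sigma>(y\<^sub>0) \<dots> \<sigma>(y\<^sub>n)\<close> and
  \<open>\<sigma>(y\<^sub>n) \<dots> \<sigma>(y\<^sub>-\<^sub>1)\<close> are long enough to contain the coordinate \<open>n\<close>.\<close>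

definition ext_seq :: "'a morphism \<Rightarrow> (int \<Rightarrow> 'a) \<Rightarrow> (int \<Rightarrow> 'a)" where
  "ext_seq \<sigma> y = (\<lambda>n. if 0 \<le> n
     then ext_word \<sigma> (map y [0..n]) ! nat n
     else rev (ext_word \<sigma> (map y [n..-1])) ! nat (- n - 1))"

definition nonerasing_morphism :: "'a set \<Rightarrow> 'a set \<Rightarrow> 'a morphism \<Rightarrow> bool" where
  "nonerasing_morphism A B \<sigma> \<longleftrightarrow> (\<forall>a\<in>A. \<sigma> a \<in> lists B \<and> \<sigma> a \<noteq> [])"

definition constant_length :: "'a set \<Rightarrow> 'a morphism \<Rightarrow> bool" where
  "constant_length A \<sigma> \<longleftrightarrow> (\<forall>a\<in>A. \<forall>b\<in>A. length (\<sigma> a) = length (\<sigma> b))"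

definition morphism_length :: "'a set \<Rightarrow> 'a morphism \<Rightarrow> nat" where
  "morphism_length A \<sigma> = (THE l. \<forall>a\<in>A. length (\<sigma> a) = l)"

definition proper_morphism :: "'a set \<Rightarrow> 'a set \<Rightarrow> 'a morphism \<Rightarrow> bool" where
  "proper_morphism A B \<sigma> \<longleftrightarrow>
     (\<exists>p\<in>B. \<exists>s\<in>B. \<forall>a\<in>A. \<sigma> a \<noteq> [] \<and> hd (\<sigma> a) = p \<and> last (\<sigma> a) = s)"

definition coinc :: "'a set \<Rightarrow> 'a morphism \<Rightarrow> nat set" where
  "coinc A \<sigma> = {i. i < morphism_length A \<sigma> \<and> (\<forall>a\<in>A. \<forall>b\<in>A. \<sigma> a ! i = \<sigma> b ! i)}"


section \<open>Directive sequences\<close>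

text \<open>All alphabets of a directive sequence are finite subsets of one type of letters.  When that
  type is infinite, every sequence of finite alphabets occurs up to renaming of letters.\<close>

definition directive_sequence :: "(nat \<Rightarrow> 'a set) \<Rightarrow> (nat \<Rightarrow> 'a morphism) \<Rightarrow> bool" where
  "directive_sequence A \<tau> \<longleftrightarrow>
     (\<forall>n. alphabet (A n)) \<and> (\<forall>n. nonerasing_morphism (A (Suc n)) (A n) (\<tau> n))"

text \<open>\<open>\<tau>\<^bsub>[n,N)\<^esub> = \<tau>\<^sub>n \<circ> \<dots> \<circ> \<tau>\<^bsub>N-1\<^esub>\<close>, which is the identity for \<open>n = N\<close>.\<close>

definition tau_comp :: "(nat \<Rightarrow> 'a morphism) \<Rightarrow> nat \<Rightarrow> nat \<Rightarrow> 'a morphism" where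
  "tau_comp \<tau> n N a = foldr (\<lambda>i. ext_word (\<tau> i)) [n..<N] [a]"

definition constant_length_seq :: "(nat \<Rightarrow> 'a set) \<Rightarrow> (nat \<Rightarrow> 'a morphism) \<Rightarrow> bool" where
  "constant_length_seq A \<tau> \<longleftrightarrow> (\<forall>n. constant_length (A (Suc n)) (\<tau> n))"

definition proper_seq :: "(nat \<Rightarrow> 'a set) \<Rightarrow> (nat \<Rightarrow> 'a morphism) \<Rightarrow> bool" where
  "proper_seq A \<tau> \<longleftrightarrow> (\<forall>n\<ge>1. proper_morphism (A (Suc n)) (A n) (\<tau> n))"

definition primitive_seq :: "(nat \<Rightarrow> 'a set) \<Rightarrow> (nat \<Rightarrow> 'a morphism) \<Rightarrow> bool" where
  "primitive_seq A \<tau> \<longleftrightarrow> (\<forall>n. \<exists>N>n. \<forall>a\<in>A N. A n \<subseteq> set (tau_comp \<tau> n N a))"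

definition language :: "(nat \<Rightarrow> 'a set) \<Rightarrow> (nat \<Rightarrow> 'a morphism) \<Rightarrow> nat \<Rightarrow> 'a list set" where
  "language A \<tau> n = {w \<in> lists (A n). \<exists>N>n. \<exists>a\<in>A N. sublist w (tau_comp \<tau> n N a)}"

definition X_level ::
    "(nat \<Rightarrow> 'a set) \<Rightarrow> (nat \<Rightarrow> 'a morphism) \<Rightarrow> nat \<Rightarrow> (int \<Rightarrow> 'a) set" where
  "X_level A \<tau> n = {y. range y \<subseteq> A n \<and> (\<forall>i j. map y [i..j] \<in> language A \<tau> n)}"

definition generates ::
    "(nat \<Rightarrow> 'a set) \<Rightarrow> (nat \<Rightarrow> 'a morphism) \<Rightarrow> (int \<Rightarrow> 'a) set \<Rightarrow> bool" where
  "generates A \<tau> X \<longleftrightarrow> X = X_level A \<tau> 0"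

definition cylinder ::
    "(nat \<Rightarrow> 'a set) \<Rightarrow> (nat \<Rightarrow> 'a morphism) \<Rightarrow> nat \<Rightarrow> 'a \<Rightarrow> (int \<Rightarrow> 'a) set" where
  "cylinder A \<tau> n a = {y \<in> X_level A \<tau> n. y 0 = a}"

definition tower_level ::
    "(nat \<Rightarrow> 'a set) \<Rightarrow> (nat \<Rightarrow> 'a morphism) \<Rightarrow> nat \<Rightarrow> 'a \<times> nat \<Rightarrow> (int \<Rightarrow> 'a) set" where
  "tower_level A \<tau> n = (\<lambda>(a, k). (shift ^^ k) ` ext_seq (tau_comp \<tau> 0 n) ` cylinder A \<tau> n a)"

definition tower_index ::
    "(nat \<Rightarrow> 'a set) \<Rightarrow> (nat \<Rightarrow> 'a morphism) \<Rightarrow> nat \<Rightarrow> ('a \<times> nat) set" where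
  "tower_index A \<tau> n = (SIGMA a:A n. {..<length (tau_comp \<tau> 0 n a)})"

text \<open>The disjointness condition is on the indexed family: a set occurring under two different
  indices is excluded, which \<^const>\<open>partition_on\<close> alone would allow.\<close>

definition recognizable :: "(nat \<Rightarrow> 'a set) \<Rightarrow> (nat \<Rightarrow> 'a morphism) \<Rightarrow> bool" where
  "recognizable A \<tau> \<longleftrightarrow> (\<forall>n.
     disjoint_family_on (tower_level A \<tau> n) (tower_index A \<tau> n) \<and>
     partition_on (X_level A \<tau> 0) (tower_level A \<tau> n ` tower_index A \<tau> n))"

definition is_contraction ::
    "(nat \<Rightarrow> 'a set) \<Rightarrow> (nat \<Rightarrow> 'a morphism) \<Rightarrow>
     (nat \<Rightarrow> 'a set) \<Rightarrow> (nat \<Rightarrow> 'a morphism) \<Rightarrow> bool" where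
  "is_contraction A \<tau> A' \<tau>' \<longleftrightarrow> (\<exists>m. m 0 = 0 \<and> strict_mono m \<and>
     A' = (\<lambda>k. A (m k)) \<and> \<tau>' = (\<lambda>k. tau_comp \<tau> (m k) (m (Suc k))))"

definition has_coincidences :: "(nat \<Rightarrow> 'a set) \<Rightarrow> (nat \<Rightarrow> 'a morphism) \<Rightarrow> bool" where
  "has_coincidences A \<tau> \<longleftrightarrow>
     (\<exists>A' \<tau>'. is_contraction A \<tau> A' \<tau>' \<and> (\<forall>k. coinc (A' (Suc k)) (\<tau>' k) \<noteq> {}))"

end

theory Submission
  imports Defs
begin

text \<open>A Toeplitz sequence \<open>x\<close> admits periods \<open>p\<^sub>0 = 1\<close>, \<open>p\<^sub>n | p\<^bsub>n+1\<^esub>\<close>, such that the coordinates in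
  \<open>[-p\<^sub>n, p\<^sub>n)\<close> are \<open>p\<^bsub>n+1\<^esub>\<close>-periodic and \<open>p\<^sub>n\<close> is the minimal period of the \<open>p\<^sub>n\<close>-skeleton of \<open>x\<close>.
  Cutting the blocks of \<open>x\<close> on \<open>[i p\<^bsub>n+1\<^esub>, (i+1) p\<^bsub>n+1\<^esub>)\<close> into blocks of length \<open>p\<^sub>n\<close> gives the directive
  sequence: the first condition makes it proper and primitive, and minimality makes it recognizable, as
  two phases of the same point would differ by a period of the skeleton.

  A proper directive sequence has a coincidence at position \<open>0\<close> after composing morphisms in pairs.

  Conversely, composing with further morphisms moves the coincidences to the interior of the blocks,
  so that the nested coincident blocks exhaust \<open>\<int>\<close> and define a point of \<open>X\<close> each coordinate of which
  is periodic. Its orbit is dense by primitivity, and it is not periodic because recognizability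
  splits \<open>X\<close> into arbitrarily high towers.\<close>

section \<open>Morphisms and languages\<close>

lemma ext_word_single [simp]: "ext_word \<sigma> [a] = \<sigma> a"
  by (simp add: ext_word_def)

lemma ext_word_ext_word: "ext_word \<sigma> (ext_word \<rho> w) = ext_word (\<lambda>a. ext_word \<sigma> (\<rho> a)) w"
  by (induction w) (auto simp: ext_word_def)

text \<open>A composite of extensions is again the extension of its values on letters; this turns
  the fold in \<open>tau_comp\<close> into a composition of morphisms.\<close>

lemma foldr_ext_word:
  "foldr (\<lambda>i. ext_word (\<tau> i)) is w = ext_word (\<lambda>a. foldr (\<lambda>i. ext_word (\<tau> i)) is [a]) w"
proof (induction "is" arbitrary: w)
  case Nil
  then show ?case by (induction w) (auto simp: ext_word_def)
next
  case (Cons i "is")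
  show ?case
    by (simp add: Cons[of w] ext_word_ext_word)
qed

lemma tau_comp_same [simp]: "tau_comp \<tau> n n a = [a]"
  by (simp add: tau_comp_def)

lemma tau_comp_split:
  assumes "n \<le> M" "M \<le> N"
  shows "tau_comp \<tau> n N a = ext_word (tau_comp \<tau> n M) (tau_comp \<tau> M N a)"
proof -
  have "[n..<N] = [n..<M] @ [M..<N]"
    using assms upt_add_eq_append[of n M "N - M"] by simp
  then have "tau_comp \<tau> n N a = foldr (\<lambda>i. ext_word (\<tau> i)) [n..<M] (tau_comp \<tau> M N a)"
    by (simp add: tau_comp_def)
  then show ?thesis
    by (subst (asm) foldr_ext_word) (simp add: tau_comp_def[abs_def])
qed

lemma tau_comp_Suc [simp]: "tau_comp \<tau> n (Suc n) a = \<tau> n a"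
  by (simp add: tau_comp_def)

lemma length_ext_word:
  assumes "\<And>a. a \<in> set w \<Longrightarrow> length (\<sigma> a) = L"
  shows "length (ext_word \<sigma> w) = L * length w"
  using assms by (induction w) (auto simp: ext_word_def)

lemma nth_ext_word:
  assumes "\<And>a. a \<in> set w \<Longrightarrow> length (\<sigma> a) = L" and "q < length w" and "r < L"
  shows "ext_word \<sigma> w ! (q * L + r) = \<sigma> (w ! q) ! r"
  using assms
proof (induction w arbitrary: q)
  case Nil
  then show ?case by simp
next
  case (Cons b w)
  then show ?case
    by (cases q) (auto simp: ext_word_def nth_append)
qed

text \<open>Floor division unites the two half-lines: coordinate \<open>n\<close> lies in the block
  with index \<open>n div int L\<close> at offset \<open>n mod int L\<close>, for negative
  \<open>n\<close> as well.\<close>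

lemma ext_seq_constant_length:
  assumes L: "\<And>a. a \<in> range y \<Longrightarrow> length (\<sigma> a) = L" and "L > 0"
  shows "ext_seq \<sigma> y n = \<sigma> (y (n div int L)) ! nat (n mod int L)"
proof (cases "0 \<le> n")
  case True
  define q r where "q = nat (n div int L)" and "r = nat (n mod int L)"
  have r: "r < L" using \<open>L > 0\<close> by (simp add: r_def nat_less_iff)
  have qi: "int q = n div int L" using True by (simp add: q_def pos_imp_zdiv_nonneg_iff \<open>L > 0\<close>)
  have ri: "int r = n mod int L" using \<open>L > 0\<close> by (simp add: r_def)
  have n: "nat n = q * L + r"
  proof -
    have "int (q * L + r) = n" by (simp add: qi ri)
    then show ?thesis by linarith
  qed
  have "q * 1 \<le> q * L" using \<open>L > 0\<close> by (intro mult_le_mono) auto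
  then have "q \<le> nat n" unfolding n by linarith
  then have q: "q < length (map y [0..n])" using True by simp
  have "ext_seq \<sigma> y n = ext_word \<sigma> (map y [0..n]) ! (q * L + r)"
    using True by (simp add: ext_seq_def n)
  also have "\<dots> = \<sigma> (map y [0..n] ! q) ! r"
    using q r by (intro nth_ext_word L) auto
  also have "map y [0..n] ! q = y (n div int L)"
    using q qi True by simp
  finally show ?thesis by (simp add: r_def)
next
  case False
  \<comment> \<open>The list \<open>[n..-1]\<close> starts at \<open>n\<close>, so \<open>q\<close>
    is the place in it of the letter with index \<open>n div int L\<close>.\<close>
  define q r where "q = nat (n div int L - n)" and "r = nat (n mod int L)"
  have r: "r < L" using \<open>L > 0\<close> by (simp add: r_def nat_less_iff)
  have ri: "int r = n mod int L" using \<open>L > 0\<close> by (simp add: r_def)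
  have dm: "n div int L * int L + n mod int L = n" by simp
  have neg: "n div int L < 0" using False \<open>L > 0\<close> by (intro div_neg_pos_less0) auto
  have "n \<le> n div int L"
  proof -
    show ?thesis
    proof (rule ccontr)
      assume "\<not> ?thesis"
      then have "n div int L + 1 \<le> n" by simp
      then have "(n div int L + 1) * int L \<le> n * int L" using \<open>L > 0\<close> by (intro mult_right_mono) auto
      moreover have "n * int L \<le> n * 1"
        using False \<open>L > 0\<close> by (intro mult_left_mono_neg) auto
      ultimately show False
        using dm pos_mod_bound[of "int L" n] \<open>L > 0\<close> unfolding distrib_right by linarith
    qed
  qed
  then have qi: "int q = n div int L - n" by (simp add: q_def)
  define w where "w = map y [n..-1]"
  have lw: "int (length w) = - n" using False by (simp add: w_def)
  have q: "q < length w" using qi lw neg by linarith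
  have le: "length (ext_word \<sigma> w) = L * length w"
    by (intro length_ext_word L) (auto simp: w_def)
  \<comment> \<open>On negative coordinates \<open>ext_seq\<close> counts from the right end; this
    converts the count to one from the left end.\<close>
  have ind: "L * length w - Suc (nat (- n - 1)) = q * L + r"
  proof -
    have "int (q * L + r) + (- n) = int (L * length w)"
      using dm by (simp add: qi lw ri algebra_simps)
    then show ?thesis using False by linarith
  qed
  have lt: "nat (- n - 1) < L * length w"
  proof -
    have "1 * length w \<le> L * length w" using \<open>L > 0\<close> by (intro mult_le_mono) auto
    then show ?thesis using lw False by linarith
  qed
  have "ext_seq \<sigma> y n = ext_word \<sigma> w ! (q * L + r)"
    using False lt by (simp add: ext_seq_def w_def[symmetric] rev_nth le ind)
  also have "\<dots> = \<sigma> (w ! q) ! r"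
    using q r by (intro nth_ext_word L) (auto simp: w_def)
  also have "w ! q = y (n div int L)"
    using q qi by (simp add: w_def)
  finally show ?thesis by (simp add: r_def)
qed

lemma funpow_shift: "(shift ^^ k) y = (\<lambda>n. y (n + int k))"
  by (induction k) (auto simp: shift_def algebra_simps)

lemma sublist_iff_nth:
  "sublist w v \<longleftrightarrow> (\<exists>k. k + length w \<le> length v \<and> (\<forall>r<length w. v ! (k + r) = w ! r))"
proof
  assume "sublist w v"
  then obtain ps ss where "v = ps @ w @ ss" by (auto simp: sublist_def)
  then show "\<exists>k. k + length w \<le> length v \<and> (\<forall>r<length w. v ! (k + r) = w ! r)"
    by (intro exI[of _ "length ps"]) (auto simp: nth_append)
next
  assume "\<exists>k. k + length w \<le> length v \<and> (\<forall>r<length w. v ! (k + r) = w ! r)"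
  then obtain k where k: "k + length w \<le> length v" "\<forall>r<length w. v ! (k + r) = w ! r"
    by auto
  have "take (length w) (drop k v) = w"
    using k by (intro nth_equalityI) auto
  then have "v = take k v @ w @ drop (length w) (drop k v)"
    by (metis append_take_drop_id)
  then show "sublist w v" by (auto simp: sublist_def)
qed

text \<open>Factors are matched through an integer offset \<open>k\<close> instead of list slices,
  so that windows can be moved by arithmetic. Even an empty window needs a letter of a later level,
  since its word must occur in some image.\<close>

lemma X_level_iff:
  assumes "\<And>n. B n \<noteq> {}"
  shows "y \<in> X_level B \<tau> n \<longleftrightarrow> range y \<subseteq> B n \<and>
    (\<forall>i j. \<exists>N>n. \<exists>a\<in>B N. \<exists>k. \<forall>t\<in>{i..j}. 0 \<le> t + k \<and>
       t + k < int (length (tau_comp \<tau> n N a)) \<and> tau_comp \<tau> n N a ! nat (t + k) = y t)"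
proof -
  have local: "map y [i..j] \<in> language B \<tau> n \<longleftrightarrow> (\<exists>N>n. \<exists>a\<in>B N. \<exists>k. \<forall>t\<in>{i..j}. 0 \<le> t + k \<and>
       t + k < int (length (tau_comp \<tau> n N a)) \<and> tau_comp \<tau> n N a ! nat (t + k) = y t)"
    if y: "range y \<subseteq> B n" for i j
  proof (cases "i \<le> j")
    case False
    obtain a where "a \<in> B (Suc n)" using assms by blast
    then have "\<exists>N>n. \<exists>a\<in>B N. True" by blast
    then show ?thesis using False by (auto simp: language_def)
  next
    case True
    have "sublist (map y [i..j]) v \<longleftrightarrow>
      (\<exists>k. \<forall>t\<in>{i..j}. 0 \<le> t + k \<and> t + k < int (length v) \<and> v ! nat (t + k) = y t)" for v
    proof
      assume "sublist (map y [i..j]) v"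
      then obtain k where k: "k + nat (j - i + 1) \<le> length v"
          "\<And>r. r < nat (j - i + 1) \<Longrightarrow> v ! (k + r) = map y [i..j] ! r"
        by (auto simp: sublist_iff_nth)
      have "0 \<le> t + (int k - i) \<and> t + (int k - i) < int (length v) \<and> v ! nat (t + (int k - i)) = y t"
        if "t \<in> {i..j}" for t
      proof -
        have "nat (t + (int k - i)) = k + nat (t - i)" using that by auto
        moreover have "v ! (k + nat (t - i)) = y t"
          using that by (subst k) auto
        ultimately show ?thesis using k(1) that by auto
      qed
      then show "\<exists>k. \<forall>t\<in>{i..j}. 0 \<le> t + k \<and> t + k < int (length v) \<and> v ! nat (t + k) = y t"
        by blast
    next
      assume "\<exists>k. \<forall>t\<in>{i..j}. 0 \<le> t + k \<and> t + k < int (length v) \<and> v ! nat (t + k) = y t"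
      then obtain k where k: "\<And>t. t \<in> {i..j} \<Longrightarrow>
        0 \<le> t + k \<and> t + k < int (length v) \<and> v ! nat (t + k) = y t" by blast
      show "sublist (map y [i..j]) v"
        unfolding sublist_iff_nth
      proof (intro exI[of _ "nat (i + k)"] conjI allI impI)
        show "nat (i + k) + length (map y [i..j]) \<le> length v"
          using k[of i] k[of j] True by auto
      next
        fix r assume "r < length (map y [i..j])"
        then have r: "i + int r \<in> {i..j}" by auto
        have "nat (i + int r + k) = nat (i + k) + r"
          using k[of i] True by auto
        then show "v ! (nat (i + k) + r) = map y [i..j] ! r"
          using k[OF r] r by auto
      qed
    qed
    moreover have "y t \<in> B n" for t using y by blast
    then have "map y [i..j] \<in> lists (B n)" by auto
    ultimately show ?thesis by (simp add: language_def)
  qed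
  show ?thesis
  proof (cases "range y \<subseteq> B n")
    case True
    then show ?thesis by (simp only: X_level_def mem_Collect_eq local)
  qed (simp add: X_level_def)
qed

section \<open>Closures in the full shift\<close>

lemma topspace_full_shift: "topspace (full_shift A) = {y. range y \<subseteq> A}"
  by (auto simp: full_shift_def PiE_def Pi_def)

text \<open>In a product of discrete spaces a basic neighbourhood restricts finitely many
  coordinates, and these lie in an interval.\<close>

lemma closure_of_full_shift:
  assumes "alphabet A" "S \<subseteq> {y. range y \<subseteq> A}"
  shows "full_shift A closure_of S =
    {y. range y \<subseteq> A \<and> (\<forall>i j. \<exists>s\<in>S. \<forall>t\<in>{i..j}. s t = y t)}" (is "?L = ?R")
proof (intro equalityI subsetI)
  fix y assume y: "y \<in> ?L"
  have r: "range y \<subseteq> A" using y by (auto simp: in_closure_of topspace_full_shift)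
  have "\<exists>s\<in>S. \<forall>t\<in>{i..j}. s t = y t" for i j
  proof -
    define U where "U = (\<lambda>t. if t \<in> {i..j} then {y t} else A)"
    have "openin (full_shift A) (PiE UNIV U)"
      unfolding full_shift_def
    proof (intro openin_PiE_gen[THEN iffD2] disjI2 conjI ballI)
      show "finite {t \<in> UNIV. U t \<noteq> topspace (discrete_topology A)}"
        by (rule finite_subset[of _ "{i..j}"]) (auto simp: U_def)
    qed (use r in \<open>auto simp: U_def\<close>)
    moreover have "y \<in> PiE UNIV U" using r by (auto simp: U_def)
    ultimately obtain s where "s \<in> S" "s \<in> PiE UNIV U"
      using y by (meson in_closure_of)
    then show ?thesis
      by (intro bexI[of _ s]) (auto simp: U_def PiE_def Pi_def split: if_splits)
  qed
  then show "y \<in> ?R" using r by auto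
next
  fix y assume y: "y \<in> ?R"
  show "y \<in> ?L"
    unfolding in_closure_of
  proof (intro conjI allI impI)
    show "y \<in> topspace (full_shift A)" using y by (auto simp: topspace_full_shift)
  next
    fix T assume T: "y \<in> T \<and> openin (full_shift A) T"
    then obtain U where U: "finite {t. U t \<noteq> A}" "y \<in> PiE UNIV U" "PiE UNIV U \<subseteq> T"
      unfolding full_shift_def openin_product_topology_alt by fastforce
    obtain b where b: "\<And>t. U t \<noteq> A \<Longrightarrow> \<bar>t\<bar> \<le> b"
    proof -
      have "finite (abs ` {t. U t \<noteq> A})" using U by simp
      then have "\<bar>t\<bar> \<le> Max (abs ` {t. U t \<noteq> A})" if "U t \<noteq> A" for t
        using that by (intro Max_ge) auto
      then show ?thesis using that by blast
    qed
    obtain s where s: "s \<in> S" "\<forall>t\<in>{-b..b}. s t = y t" using y by blast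
    have "s t \<in> U t" for t
    proof (cases "U t = A")
      case True
      have "range s \<subseteq> A" using s(1) assms(2) by blast
      then have "s t \<in> A" by blast
      then show ?thesis using True by simp
    next
      case False
      then have "t \<in> {-b..b}" using b[of t] by auto
      then have "s t = y t" using s(2) by blast
      then show ?thesis using U(2) by auto
    qed
    then have "s \<in> T" using U(3) by auto
    then show "\<exists>s. s \<in> S \<and> s \<in> T" using s by auto
  qed
qed

lemma closure_of_orbit:
  assumes "alphabet A" "range x \<subseteq> A"
  shows "full_shift A closure_of orbit x = {y. \<forall>i j. \<exists>k. \<forall>t\<in>{i..j}. y t = x (t + k)}"
proof -
  have "range y \<subseteq> A" if y: "\<forall>i j. \<exists>k. \<forall>t\<in>{i..j}. y t = x (t + k)" for y
  proof clarify
    fix t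
    obtain k where "\<forall>s\<in>{t..t}. y s = x (s + k)" using y by blast
    then have "y t = x (t + k)" by simp
    then show "y t \<in> A" using assms by auto
  qed
  moreover have "orbit x \<subseteq> {y. range y \<subseteq> A}"
    using assms by (auto simp: orbit_def)
  ultimately show ?thesis
    using assms by (subst closure_of_full_shift) (auto simp: orbit_def Bex_def eq_commute)
qed

section \<open>Essential periods\<close>

lemma Per_D: "j \<in> Per q x \<Longrightarrow> x (j + k * int q) = x j"
proof -
  assume "j \<in> Per q x"
  then obtain c where c: "\<And>k. x (j + k * int q) = c"
    unfolding Per_def constant_on_def by blast
  from c[of k] c[of 0] show ?thesis by simp
qed

lemma Per_iff: "j \<in> Per q x \<longleftrightarrow> (\<forall>k. x (j + k * int q) = x j)"
  using Per_D[of j q x] by (auto simp: Per_def constant_on_def)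

lemma Per_mono:
  assumes "p dvd q" shows "Per p x \<subseteq> Per q x"
proof
  fix j assume j: "j \<in> Per p x"
  obtain c where q: "q = p * c" using assms by auto
  have "x (j + k * int q) = x j" for k
    using Per_D[OF j, of "k * int c"] by (simp add: q algebra_simps)
  then show "j \<in> Per q x" by (simp add: Per_iff)
qed

lemma Per_translate: "j \<in> Per q x \<Longrightarrow> j + k * int q \<in> Per q x"
  using Per_D[of j q x "k + _"] Per_D[of j q x k] unfolding Per_iff by (simp add: algebra_simps)

text \<open>The \<open>q\<close>-skeleton of Toeplitz theory. \<open>None\<close> marks the holes,
  so a period of it has to preserve holes and letters alike.\<close>

definition skel :: "nat \<Rightarrow> (int \<Rightarrow> 'a) \<Rightarrow> int \<Rightarrow> 'a option" where
  "skel q x j = (if j \<in> Per q x then Some (x j) else None)"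

text \<open>Minimality of \<open>q\<close> as a period of the skeleton, in divisibility form:
  together with \<open>skel_period\<close> it makes the periods exactly the multiples of
  \<open>q\<close>.\<close>

definition essential :: "nat \<Rightarrow> (int \<Rightarrow> 'a) \<Rightarrow> bool" where
  "essential q x \<longleftrightarrow> (\<forall>d. (\<forall>j. skel q x (j + d) = skel q x j) \<longrightarrow> int q dvd d)"

lemma skel_translate: "skel q (\<lambda>t. x (t + k)) j = skel q x (j + k)"
  unfolding skel_def Per_iff by (simp add: algebra_simps)

lemma skel_period: "skel q x (j + k * int q) = skel q x j"
proof (cases "j \<in> Per q x")
  case True
  then show ?thesis by (simp add: skel_def Per_translate Per_D)
next
  case False
  then have "j + k * int q \<notin> Per q x"
    using Per_translate[of "j + k * int q" q x "-k"] by auto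
  then show ?thesis using False by (simp add: skel_def)
qed

text \<open>Periods of the skeleton form a subgroup of the integers containing \<open>q\<close>; its
  least positive element \<open>p\<close> divides all of them. Periodicity of the skeleton modulo
  \<open>p\<close> puts its filled positions into \<open>Per p x\<close>.\<close>

lemma essential_exists:
  assumes "q \<ge> 1"
  obtains p where "p \<ge> 1" "p dvd q" "Per p x = Per q x" "essential p x"
proof -
  define P where "P = (\<lambda>d. \<forall>j. skel q x (j + d) = skel q x j)"
  define p where "p = (LEAST p. p \<ge> 1 \<and> P (int p))"
  have Pq: "P (int q)" using skel_period[of q x _ 1] by (simp add: P_def)
  have p: "p \<ge> 1" "P (int p)"
    using LeastI[of "\<lambda>p. p \<ge> 1 \<and> P (int p)" q] assms Pq by (auto simp: p_def)
  have least: "p \<le> d" if "d \<ge> 1" "P (int d)" for d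
    unfolding p_def using that by (intro Least_le) auto
  have mult: "P (k * int p)" for k
  proof -
    have up: "P (int n * int p)" for n
    proof (induction n)
      case 0
      then show ?case by (simp add: P_def)
    next
      case (Suc n)
      have "skel q x (j + int n * int p + int p) = skel q x j" for j
        using Suc p(2) unfolding P_def by metis
      then show ?case by (simp add: P_def algebra_simps)
    qed
    show ?thesis
    proof (cases "k \<ge> 0")
      case True
      then show ?thesis using up[of "nat k"] by simp
    next
      case False
      have "skel q x (j + k * int p + (- k) * int p) = skel q x (j + k * int p)" for j
        using False up[of "nat (- k)", unfolded P_def, rule_format, of "j + k * int p"] by simp
      then have "skel q x j = skel q x (j + k * int p)" for j by simp
      then show ?thesis unfolding P_def by metis
    qed
  qed
  \<comment> \<open>The remainder of a period modulo \<open>p\<close> is again a period, smaller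
    than \<open>p\<close>, hence zero.\<close>
  have dvd: "int p dvd d" if "P d" for d
  proof -
    have "skel q x (j + d mod int p) = skel q x j" for j
    proof -
      have "skel q x (j + d mod int p) = skel q x (j + d mod int p + d div int p * int p)"
        using mult unfolding P_def by metis
      also have "\<dots> = skel q x (j + d)" by (simp add: algebra_simps)
      finally show ?thesis using that by (simp add: P_def)
    qed
    then have "P (d mod int p)" by (simp add: P_def)
    then have "\<not> 1 \<le> nat (d mod int p)"
      using least[of "nat (d mod int p)"] p(1) pos_mod_bound[of "int p" d] by fastforce
    moreover have "d mod int p \<ge> 0" using p(1) by simp
    ultimately have "d mod int p = 0" by linarith
    then show ?thesis by auto
  qed
  have pq: "p dvd q" using dvd[OF Pq] by simp
  have "Per q x \<subseteq> Per p x"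
  proof
    fix j assume j: "j \<in> Per q x"
    have "skel q x (j + k * int p) = skel q x j" for k using mult unfolding P_def by blast
    then have "x (j + k * int p) = x j" for k
      using j by (auto simp: skel_def split: if_splits) (metis option.distinct(1) option.inject)
    then show "j \<in> Per p x" by (simp add: Per_iff)
  qed
  then have eq: "Per p x = Per q x" using Per_mono[OF pq] by blast
  then have "skel p x = skel q x" by (auto simp: skel_def)
  then have "essential p x" using dvd by (simp add: essential_def P_def)
  then show ?thesis using that p pq eq by blast
qed

text \<open>Translation by \<open>p'\<close> carries progressions of difference \<open>p\<close> to
  such progressions and preserves \<open>x\<close> on \<open>Per p x\<close>, so \<open>p'\<close>
  is a period of the \<open>p\<close>-skeleton. This lets \<open>q\<close> be shrunk to an essential
  period without losing divisibility by \<open>p\<close>.\<close>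

lemma essential_dvd:
  assumes p: "essential p x" and "p dvd q" and eq: "Per p' x = Per q x"
  shows "p dvd p'"
proof -
  have sub: "Per p x \<subseteq> Per p' x" using Per_mono[OF \<open>p dvd q\<close>] eq by blast
  have per: "j + k * int p' \<in> Per p x" if j: "j \<in> Per p x" for j k
    unfolding Per_iff
  proof
    fix l
    have 1: "x (j + l * int p + k * int p') = x (j + l * int p)"
      using Per_translate[OF j] sub by (intro Per_D) auto
    have 2: "x (j + k * int p') = x j" using j sub by (intro Per_D) auto
    have "x (j + l * int p) = x j" by (rule Per_D[OF j])
    then show "x (j + k * int p' + l * int p) = x (j + k * int p')"
      using 1 2 by (simp add: add.commute add.left_commute)
  qed
  have "skel p x (j + int p') = skel p x j" for j
  proof (cases "j \<in> Per p x")
    case True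
    have "x (j + 1 * int p') = x j" using True sub by (intro Per_D) auto
    then show ?thesis using per[OF True, of 1] True by (simp add: skel_def)
  next
    case False
    then have "j + int p' \<notin> Per p x" using per[of "j + int p'" "-1"] by auto
    then show ?thesis using False by (simp add: skel_def)
  qed
  then have "int p dvd int p'" using p unfolding essential_def by blast
  then show ?thesis by simp
qed

lemma Per_finite_subset:
  assumes "(\<Union>p\<in>{1..}. Per p x) = UNIV" "finite F" "p \<ge> 1"
  obtains q where "q \<ge> 1" "p dvd q" "F \<subseteq> Per q x"
proof -
  have "\<exists>q\<ge>1. p dvd q \<and> F \<subseteq> Per q x"
    using assms(2)
  proof induction
    case empty
    then show ?case using assms(3) by auto
  next
    case (insert j F)
    then obtain q where q: "q \<ge> 1" "p dvd q" "F \<subseteq> Per q x" by auto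
    obtain r where r: "r \<ge> 1" "j \<in> Per r x" using assms(1) by fastforce
    have "Per q x \<subseteq> Per (q * r) x" "Per r x \<subseteq> Per (q * r) x"
      by (auto intro!: Per_mono)
    then show ?case using q r by (intro exI[of _ "q * r"]) auto
  qed
  then show ?thesis using that by blast
qed

section \<open>The directive sequence of a Toeplitz sequence\<close>

lemma concat_blocks:
  assumes "Q > 0" "a \<le> b + 1"
  shows "concat (map (\<lambda>j. map f [j*Q..(j+1)*Q-1]) [a..b]) = map f [a*Q..(b+1)*Q-(1::int)]"
proof -
  have "concat (map (\<lambda>j. map f [j*Q..(j+1)*Q-1]) [a..a + int n - 1]) = map f [a*Q..(a + int n)*Q-1]" for n
  proof (induction n)
    case 0
    then show ?case by simp
  next
    case (Suc n)
    have 1: "[a..a + int (Suc n) - 1] = [a..a + int n - 1] @ [a + int n]"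
      using upto_rec2[of a "a + int n"] by simp
    have 2: "[a*Q..(a + int n + 1)*Q-1] = [a*Q..(a + int n)*Q-1] @ [(a + int n)*Q..(a + int n + 1)*Q-1]"
      using assms(1) by (intro upto_split1) (auto simp: distrib_right)
    have 3: "a + int (Suc n) = a + int n + 1" by simp
    show ?case
      using Suc by (simp only: 1 map_append concat_append) (simp only: 3 2 map_append list.map concat.simps append_Nil2)
  qed
  from this[of "nat (b + 1 - a)"] show ?thesis using assms(2) by simp
qed

text \<open>Letter \<open>z n i\<close> encodes the block of \<open>x\<close> on \<open>[i p\<^sub>n, (i+1) p\<^sub>n)\<close>.\<close>

locale toeplitz_structure =
  fixes x :: "int \<Rightarrow> 'a" and p :: "nat \<Rightarrow> nat" and z :: "nat \<Rightarrow> int \<Rightarrow> 'a"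
  assumes p_0: "p 0 = 1" and p_dvd: "p n dvd p (Suc n)" and p_less: "p n < p (Suc n)"
    and Per_p: "{- int (p n)..<int (p n)} \<subseteq> Per (p (Suc n)) x"
    and essential_p: "essential (p n) x"
    and z_0: "z 0 = x"
    and z_eq: "z n i = z n j \<longleftrightarrow>
      (\<forall>r\<in>{0..<int (p n)}. x (i * int (p n) + r) = x (j * int (p n) + r))"
    and finite_x: "finite (range x)"
begin

definition P :: "nat \<Rightarrow> int" where "P n = int (p n)"

text \<open>For \<open>n \<le> N\<close>, the number of blocks of level \<open>n\<close> in a block
  of level \<open>N\<close>, hence the length of the composed morphism.\<close>

definition Q :: "nat \<Rightarrow> nat \<Rightarrow> int" where "Q n N = P N div P n"

text \<open>The image of a letter is read off at an arbitrary occurrence of it;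
  \<open>\<tau>_z\<close> shows that the choice does not matter.\<close>

definition \<tau> :: "nat \<Rightarrow> 'a morphism" where
  "\<tau> n a = (let i = SOME i. z (Suc n) i = a in map (z n) [i * Q n (Suc n)..(i + 1) * Q n (Suc n) - 1])"

abbreviation B :: "nat \<Rightarrow> 'a set" where "B n \<equiv> range (z n)"

section \<open>Arithmetic of block lengths\<close>

lemma P_pos: "P n > 0"
proof (cases n)
  case 0
  then show ?thesis by (simp add: P_def p_0)
next
  case (Suc m)
  then show ?thesis using p_less[of m] by (simp add: P_def)
qed

lemma P_0 [simp]: "P 0 = 1" by (simp add: P_def p_0)

lemma P_dvd: "n \<le> N \<Longrightarrow> P n dvd P N"
  by (induction N rule: dec_induct) (use p_dvd in \<open>auto simp: P_def intro: dvd_trans\<close>)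

lemma P_Q: "n \<le> N \<Longrightarrow> P n * Q n N = P N"
  using P_dvd by (simp add: Q_def)

lemma Q_pos: "n \<le> N \<Longrightarrow> Q n N > 0"
  using P_Q[of n N] P_pos[of n] P_pos[of N] by (metis zero_less_mult_pos)

lemma Q_trans:
  assumes "n \<le> M" "M \<le> N" shows "Q n M * Q M N = Q n N"
proof -
  have "P n * (Q n M * Q M N) = P n * Q n N"
    using P_Q[of n M] P_Q[of M N] P_Q[of n N] assms by (simp flip: mult.assoc)
  then show ?thesis using P_pos[of n] by simp
qed

lemma Q_same [simp]: "Q n n = 1"
  using P_pos[of n] by (simp add: Q_def)

text \<open>A proper multiple is at least twice as large. The factor 2 makes room for translated
  windows in \<open>X_level_z\<close>.\<close>

lemma Q_Suc_ge: "n \<le> M \<Longrightarrow> 2 * Q n M \<le> Q n (Suc M)"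
proof -
  assume nM: "n \<le> M"
  have "P M * 1 < P M * Q M (Suc M)" using p_less[of M] P_Q[of M "Suc M"] by (simp add: P_def)
  then have "Q M (Suc M) \<ge> 2" using P_pos[of M] by (simp only: mult_less_cancel_left) auto
  then have "Q n M * 2 \<le> Q n M * Q M (Suc M)"
    using Q_pos[OF nM] by (intro mult_left_mono) auto
  then show ?thesis using Q_trans[of n M "Suc M"] nM by simp
qed

lemma Q_unbounded: "\<exists>M\<ge>n. b \<le> Q n M"
proof -
  have "int d \<le> Q n (n + d)" for d
  proof (induction d)
    case (Suc d)
    then show ?case using Q_Suc_ge[of n "n + d"] Q_pos[of n "n + d"] by simp
  qed simp
  from this[of "nat b"] have "b \<le> Q n (n + nat b)" by linarith
  then show ?thesis by (intro exI[of _ "n + nat b"]) auto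
qed

section \<open>Blocks of \<open>x\<close> and the morphisms cut from them\<close>

lemma z_eqI:
  assumes "\<And>r. 0 \<le> r \<Longrightarrow> r < P n \<Longrightarrow> x (i * P n + r) = x (j * P n + r)"
  shows "z n i = z n j"
  using assms unfolding z_eq P_def by auto

lemma z_eqD: "z n i = z n j \<Longrightarrow> 0 \<le> r \<Longrightarrow> r < P n \<Longrightarrow> x (i * P n + r) = x (j * P n + r)"
  unfolding z_eq P_def by auto

lemma block_index:
  assumes "0 \<le> s" "s < Q n N" "0 \<le> r" "r < P n" "n \<le> N"
  shows "0 \<le> s * P n + r" "s * P n + r < P N"
proof -
  show "0 \<le> s * P n + r" using assms P_pos[of n] by simp
  have "(s + 1) * P n \<le> Q n N * P n" using assms P_pos[of n] by (intro mult_right_mono) auto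
  then show "s * P n + r < P N" using assms P_Q[of n N] by (simp add: algebra_simps)
qed

lemma z_eq_sub:
  assumes "z N i = z N j" "n \<le> N" "0 \<le> s" "s < Q n N"
  shows "z n (i * Q n N + s) = z n (j * Q n N + s)"
proof (rule z_eqI)
  fix r assume r: "0 \<le> r" "r < P n"
  have "x (i * P N + (s * P n + r)) = x (j * P N + (s * P n + r))"
    using assms r block_index[of s n N r] by (intro z_eqD) auto
  then show "x ((i * Q n N + s) * P n + r) = x ((j * Q n N + s) * P n + r)"
    using P_Q[OF assms(2)] by (simp add: algebra_simps)
qed

text \<open>Equal letters of level \<open>Suc n\<close> stand for equal blocks of \<open>x\<close>,
  and these are cut into equal blocks of length \<open>P n\<close>.\<close>

lemma \<tau>_z: "\<tau> n (z (Suc n) i) = map (z n) [i * Q n (Suc n)..(i + 1) * Q n (Suc n) - 1]"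
proof -
  define i' where "i' = (SOME j. z (Suc n) j = z (Suc n) i)"
  have i': "z (Suc n) i' = z (Suc n) i" unfolding i'_def by (rule someI) simp
  have "map (z n) [i' * Q n (Suc n)..(i' + 1) * Q n (Suc n) - 1]
      = map (z n) [i * Q n (Suc n)..(i + 1) * Q n (Suc n) - 1]"
  proof (rule nth_equalityI)
    fix s assume "s < length (map (z n) [i' * Q n (Suc n)..(i' + 1) * Q n (Suc n) - 1])"
    then have s: "int s < Q n (Suc n)" by (auto simp: algebra_simps)
    then show "map (z n) [i' * Q n (Suc n)..(i' + 1) * Q n (Suc n) - 1] ! s
        = map (z n) [i * Q n (Suc n)..(i + 1) * Q n (Suc n) - 1] ! s"
      using z_eq_sub[OF i', of n "int s"] by (simp add: algebra_simps)
  qed (simp add: algebra_simps)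
  then show ?thesis by (simp add: \<tau>_def i'_def Let_def)
qed

text \<open>Consecutive segments of \<open>z n\<close> concatenate to a segment, so composing the
  morphisms amounts to cutting blocks of level \<open>N\<close> directly into blocks of level
  \<open>n\<close>.\<close>

lemma tau_comp_z:
  assumes "n \<le> N"
  shows "tau_comp \<tau> n N (z N i) = map (z n) [i * Q n N..(i + 1) * Q n N - 1]"
  using assms
proof (induction N arbitrary: i rule: dec_induct)
  case base
  then show ?case by simp
next
  case (step N)
  have Q: "Q n N > 0" "Q N (Suc N) > 0" "Q n (Suc N) = Q N (Suc N) * Q n N"
    using step.hyps Q_pos[of n N] Q_pos[of N "Suc N"] Q_trans[of n N "Suc N"]
    by (auto simp: mult.commute)
  have "tau_comp \<tau> n (Suc N) (z (Suc N) i) =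
      ext_word (tau_comp \<tau> n N) (map (z N) [i * Q N (Suc N)..(i + 1) * Q N (Suc N) - 1])"
    using step.hyps by (subst tau_comp_split[of _ N]) (auto simp: \<tau>_z)
  also have "\<dots> = concat (map (\<lambda>j. map (z n) [j * Q n N..(j + 1) * Q n N - 1])
      [i * Q N (Suc N)..(i + 1) * Q N (Suc N) - 1])"
    by (simp add: ext_word_def comp_def step.IH)
  also have "\<dots> = map (z n) [i * Q N (Suc N) * Q n N..((i + 1) * Q N (Suc N) - 1 + 1) * Q n N - 1]"
    using Q by (intro concat_blocks) (auto simp: algebra_simps)
  finally show ?case by (simp add: Q(3) mult.assoc)
qed

lemma length_tau_comp_z: "n \<le> N \<Longrightarrow> length (tau_comp \<tau> n N (z N i)) = nat (Q n N)"
  by (simp add: tau_comp_z algebra_simps)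

lemma nth_tau_comp_z:
  "n \<le> N \<Longrightarrow> 0 \<le> t \<Longrightarrow> t < Q n N \<Longrightarrow> tau_comp \<tau> n N (z N i) ! nat t = z n (i * Q n N + t)"
  by (simp add: tau_comp_z algebra_simps)

lemma finite_B: "finite (B n)"
proof -
  define W where "W = (\<lambda>i. map (\<lambda>r. x (i * P n + r)) [0..P n - 1])"
  have inj: "z n i = z n j" if "W i = W j" for i j
    using that by (intro z_eqI) (auto simp: W_def)
  have "B n = (\<lambda>w. z n (SOME i. W i = w)) ` range W"
  proof -
    have "z n i = z n (SOME j. W j = W i)" for i
      by (rule inj, rule sym, rule someI) simp
    then show ?thesis by (simp add: image_image cong: image_cong)
  qed
  moreover have "range W \<subseteq> {w. set w \<subseteq> range x \<and> length w = nat (P n)}"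
    by (auto simp: W_def)
  then have "finite (range W)"
    using finite_lists_length_eq[OF finite_x] finite_subset by blast
  ultimately show ?thesis by simp
qed

section \<open>Recurrence of blocks, primitivity and properness\<close>

lemma z_recur:
  assumes "n \<le> M" "- Q n M \<le> i" "i < Q n M"
  shows "z n (i + t * Q n (Suc M)) = z n i"
proof (rule z_eqI)
  fix r assume r: "0 \<le> r" "r < P n"
  \<comment> \<open>The two bounds place the block inside \<open>{- P M..<P M}\<close>, which
    \<open>Per_p\<close> makes periodic modulo \<open>P (Suc M)\<close>.\<close>
  have 1: "i * P n + r < P M"
  proof -
    have "(i + 1) * P n \<le> Q n M * P n" using assms P_pos[of n] by (intro mult_right_mono) auto
    then show ?thesis using r P_Q[OF assms(1)] by (simp add: algebra_simps)
  qed
  have 2: "- P M \<le> i * P n + r"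
  proof -
    have "(- Q n M) * P n \<le> i * P n" using assms P_pos[of n] by (intro mult_right_mono) auto
    then show ?thesis using r P_Q[OF assms(1)] by (simp add: algebra_simps)
  qed
  have "i * P n + r \<in> Per (p (Suc M)) x" using 1 2 Per_p[of M] by (auto simp: P_def)
  then have "x (i * P n + r + t * int (p (Suc M))) = x (i * P n + r)" by (rule Per_D)
  then show "x ((i + t * Q n (Suc M)) * P n + r) = x (i * P n + r)"
    using P_Q[of n "Suc M"] assms(1) by (simp add: algebra_simps P_def)
qed

text \<open>Finitely many letters all occur in one window around the origin, and by
  \<open>z_recur\<close> each of these occurrences recurs with period \<open>Q n (Suc M)\<close>,
  which bounds the gaps.\<close>

lemma letter_recur: "\<exists>N>n. \<forall>a\<in>B n. \<forall>l. \<exists>r\<in>{l..<l + Q n N}. z n r = a"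
proof -
  obtain f where f: "\<And>a. a \<in> B n \<Longrightarrow> z n (f a) = a"
    using f_inv_into_f by metis
  define b where "b = Max ((\<lambda>a. \<bar>f a\<bar>) ` B n) + 1"
  have b: "\<bar>f a\<bar> < b" if "a \<in> B n" for a
  proof -
    have "\<bar>f a\<bar> \<le> Max ((\<lambda>a. \<bar>f a\<bar>) ` B n)" using finite_B that by (intro Max_ge) auto
    then show ?thesis by (simp add: b_def)
  qed
  obtain M where M: "M \<ge> n" "b \<le> Q n M" using Q_unbounded by blast
  have "\<exists>r\<in>{l..<l + Q n (Suc M)}. z n r = a" if a: "a \<in> B n" for a l
  proof -
    \<comment> \<open>The first position from \<open>l\<close> on that is congruent to
      \<open>f a\<close> modulo \<open>Q n (Suc M)\<close>.\<close>
    define r where "r = l + (f a - l) mod Q n (Suc M)"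
    have "r = f a + (- ((f a - l) div Q n (Suc M))) * Q n (Suc M)"
      unfolding r_def using minus_div_mult_eq_mod[of "f a - l" "Q n (Suc M)"] by (simp add: algebra_simps)
    then have "z n r = z n (f a)"
      using M b[OF a] by (simp only:, intro z_recur) auto
    moreover have "r \<in> {l..<l + Q n (Suc M)}"
      using Q_pos[of n "Suc M"] M by (auto simp: r_def)
    ultimately show ?thesis using f[OF a] by auto
  qed
  then show ?thesis using M by (intro exI[of _ "Suc M"]) auto
qed

text \<open>Images of letters are segments of \<open>z n\<close>; conversely every segment of
  \<open>z n\<close> occurs in the image of a single letter. Hence level \<open>n\<close> is the
  orbit closure of \<open>z n\<close>.\<close>

lemma X_level_z: "X_level B \<tau> n = {u. \<forall>i j. \<exists>k. \<forall>t\<in>{i..j}. u t = z n (t + k)}"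
proof (intro equalityI subsetI)
  fix u assume "u \<in> X_level B \<tau> n"
  then have u: "\<exists>N>n. \<exists>a\<in>B N. \<exists>k. \<forall>t\<in>{i..j}. 0 \<le> t + k \<and>
       t + k < int (length (tau_comp \<tau> n N a)) \<and> tau_comp \<tau> n N a ! nat (t + k) = u t" for i j
    by (subst (asm) X_level_iff) auto
  show "u \<in> {u. \<forall>i j. \<exists>k. \<forall>t\<in>{i..j}. u t = z n (t + k)}"
  proof (intro CollectI allI)
    fix i j :: int
    obtain N a k where N: "N > n" "a \<in> B N" and k: "\<And>t. t \<in> {i..j} \<Longrightarrow> 0 \<le> t + k \<and>
       t + k < int (length (tau_comp \<tau> n N a)) \<and> tau_comp \<tau> n N a ! nat (t + k) = u t"
      using u[of i j] by blast
    obtain l where a: "a = z N l" using N by auto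
    have "u t = z n (t + (k + l * Q n N))" if "t \<in> {i..j}" for t
      using k[OF that] nth_tau_comp_z[of n N "t + k" l] length_tau_comp_z[of n N l] N a Q_pos[of n N]
      by (simp add: algebra_simps)
    then show "\<exists>k. \<forall>t\<in>{i..j}. u t = z n (t + k)" by blast
  qed
next
  fix u assume "u \<in> {u. \<forall>i j. \<exists>k. \<forall>t\<in>{i..j}. u t = z n (t + k)}"
  then have u: "\<exists>k. \<forall>t\<in>{i..j}. u t = z n (t + k)" for i j by blast
  have "range u \<subseteq> B n"
  proof clarify
    fix t show "u t \<in> B n" using u[of t t] by auto
  qed
  moreover have "\<exists>N>n. \<exists>a\<in>B N. \<exists>k. \<forall>t\<in>{i..j}. 0 \<le> t + k \<and>
       t + k < int (length (tau_comp \<tau> n N a)) \<and> tau_comp \<tau> n N a ! nat (t + k) = u t" for i j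
  proof -
    obtain k where k: "\<And>t. t \<in> {i..j} \<Longrightarrow> u t = z n (t + k)" using u[of i j] by blast
    obtain M where M: "M \<ge> n" "max \<bar>i + k\<bar> \<bar>j + k\<bar> + 1 \<le> Q n M" using Q_unbounded by blast
    \<comment> \<open>A segment around the origin may straddle the boundary between blocks
      \<open>-1\<close> and \<open>0\<close> of every level. Its copy one period
      \<open>Q n (Suc M)\<close> to the right lies inside block \<open>0\<close> of level
      \<open>Suc (Suc M)\<close>.\<close>
    define k' where "k' = k + Q n (Suc M)"
    have "0 \<le> t + k' \<and> t + k' < int (length (tau_comp \<tau> n (Suc (Suc M)) (z (Suc (Suc M)) 0))) \<and>
       tau_comp \<tau> n (Suc (Suc M)) (z (Suc (Suc M)) 0) ! nat (t + k') = u t" if t: "t \<in> {i..j}" for t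
    proof -
      have tk: "- Q n M \<le> t + k" "t + k < Q n M" using M t by auto
      have le: "0 \<le> t + k'" "t + k' < Q n (Suc (Suc M))"
        using tk Q_Suc_ge[of n M] Q_Suc_ge[of n "Suc M"] Q_pos[of n M] M by (auto simp: k'_def)
      have "z n (0 * Q n (Suc (Suc M)) + (t + k')) = z n (t + k + 1 * Q n (Suc M))"
        by (simp add: k'_def algebra_simps)
      also have "\<dots> = u t" using k[OF t] tk M by (simp only: z_recur)
      finally show ?thesis
        using le M by (simp add: nth_tau_comp_z length_tau_comp_z)
    qed
    then have "\<exists>k. \<forall>t\<in>{i..j}. 0 \<le> t + k \<and>
       t + k < int (length (tau_comp \<tau> n (Suc (Suc M)) (z (Suc (Suc M)) 0))) \<and>
       tau_comp \<tau> n (Suc (Suc M)) (z (Suc (Suc M)) 0) ! nat (t + k) = u t" by blast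
    moreover have "n < Suc (Suc M)" using M by simp
    ultimately show ?thesis by blast
  qed
  ultimately show "u \<in> X_level B \<tau> n" by (subst X_level_iff) auto
qed

lemma z_in_X_level: "(\<lambda>t. z n (t + k)) \<in> X_level B \<tau> n"
  unfolding X_level_z by blast

text \<open>The bound on the gaps between occurrences of a letter in \<open>z n\<close> passes to
  every point of the orbit closure.\<close>

lemma letter_in_X_level:
  assumes "u \<in> X_level B \<tau> n" "a \<in> B n"
  shows "\<exists>s. u s = a"
proof -
  obtain N where N: "N > n" "\<And>a l. a \<in> B n \<Longrightarrow> \<exists>r\<in>{l..<l + Q n N}. z n r = a"
    using letter_recur by blast
  obtain k where k: "\<forall>t\<in>{0..Q n N}. u t = z n (t + k)" using assms(1) unfolding X_level_z by blast
  obtain r where "r \<in> {k..<k + Q n N}" "z n r = a" using N(2)[OF assms(2)] by blast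
  then show ?thesis using k by (intro exI[of _ "r - k"]) auto
qed

lemma directive: "directive_sequence B \<tau>"
proof -
  have [simp]: "\<not> Q n (Suc n) < 1" for n using Q_pos[of n "Suc n"] by simp
  show ?thesis
    unfolding directive_sequence_def alphabet_def nonerasing_morphism_def
    using finite_B by (auto simp: \<tau>_z algebra_simps)
qed

lemma constant_length_\<tau>: "constant_length_seq B \<tau>"
  by (auto simp: constant_length_seq_def constant_length_def \<tau>_z algebra_simps)

lemma primitive: "primitive_seq B \<tau>"
  unfolding primitive_seq_def
proof
  fix n
  obtain N where N: "N > n" "\<And>a l. a \<in> B n \<Longrightarrow> \<exists>r\<in>{l..<l + Q n N}. z n r = a"
    using letter_recur by blast
  have "B n \<subseteq> set (tau_comp \<tau> n N (z N i))" for i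
  proof
    fix a assume "a \<in> B n"
    then obtain r where "r \<in> {i * Q n N..<i * Q n N + Q n N}" "z n r = a" using N(2) by blast
    then show "a \<in> set (tau_comp \<tau> n N (z N i))" using N(1) by (auto simp: tau_comp_z algebra_simps)
  qed
  then show "\<exists>N>n. \<forall>a\<in>B N. B n \<subseteq> set (tau_comp \<tau> n N a)" using N(1) by auto
qed

lemma proper: "proper_seq B \<tau>"
  unfolding proper_seq_def proper_morphism_def
proof (intro allI impI)
  fix n
  have "\<tau> n a \<noteq> [] \<and> hd (\<tau> n a) = z n 0 \<and> last (\<tau> n a) = z n (-1)" if aB: "a \<in> B (Suc n)" for a
  proof -
    obtain i where a: "a = z (Suc n) i" using aB by auto
    define q where "q = Q n (Suc n)"
    have q: "q > 0" using Q_pos[of n "Suc n"] by (simp add: q_def)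
    have w: "\<tau> n a = map (z n) [i * q..(i + 1) * q - 1]" by (simp add: a \<tau>_z q_def)
    have ne: "[i * q..(i + 1) * q - 1] \<noteq> []" using q by (simp add: algebra_simps)
    have lt: "i * q \<le> (i + 1) * q - 1" using q by (simp add: algebra_simps)
    have hd: "hd [i * q..(i + 1) * q - 1] = i * q"
      using upto_rec1[OF lt] by simp
    have last: "last [i * q..(i + 1) * q - 1] = (i + 1) * q - 1"
      using upto_rec2[OF lt] by simp
    \<comment> \<open>This is \<open>z_recur\<close> with \<open>M = n\<close>, where
      \<open>Q n n = 1\<close> and the window consists of the blocks \<open>-1\<close> and
      \<open>0\<close>.\<close>
    have "z n (0 + i * q) = z n 0" "z n (-1 + (i + 1) * q) = z n (-1)"
      unfolding q_def by (rule z_recur; simp)+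
    then have "z n (i * q) = z n 0" "z n ((i + 1) * q - 1) = z n (-1)"
      by (simp_all add: algebra_simps)
    then show ?thesis using ne hd last
      by (simp add: w hd_map last_map)
  qed
  then show "\<exists>p\<in>B n. \<exists>s\<in>B n. \<forall>a\<in>B (Suc n). \<tau> n a \<noteq> [] \<and> hd (\<tau> n a) = p \<and> last (\<tau> n a) = s"
    by blast
qed

section \<open>Recognizability\<close>

lemma ext_seq_\<tau>:
  assumes "u \<in> X_level B \<tau> n" "u (t div P n) = z n l"
  shows "ext_seq (tau_comp \<tau> 0 n) u t = x (l * P n + t mod P n)"
proof -
  have Q: "Q 0 n = P n" by (simp add: Q_def)
  have u: "range u \<subseteq> B n" using assms by (auto simp: X_level_def)
  have "ext_seq (tau_comp \<tau> 0 n) u t = tau_comp \<tau> 0 n (u (t div int (nat (P n)))) ! nat (t mod int (nat (P n)))"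
    using u P_pos[of n] by (intro ext_seq_constant_length) (auto simp: length_tau_comp_z Q)
  then show ?thesis
    using assms P_pos[of n] nth_tau_comp_z[of 0 n "t mod P n" l] by (simp add: Q z_0)
qed

text \<open>The image is a concatenation of blocks of \<open>x\<close> in their original phase, so
  filled positions keep their letters. Holes remain holes because every letter occurs in
  \<open>u\<close>, in particular two whose blocks differ at the hole.\<close>

lemma skel_ext_seq:
  assumes u: "u \<in> X_level B \<tau> n"
  shows "skel (p n) (ext_seq (tau_comp \<tau> 0 n) u) = skel (p n) x"
proof
  fix j
  define y where "y = ext_seq (tau_comp \<tau> 0 n) u"
  have yv: "y t = x (l * P n + t mod P n)" if "u (t div P n) = z n l" for t l
    using ext_seq_\<tau>[OF u that] by (simp add: y_def)
  have uB: "\<exists>l. u s = z n l" for s using u unfolding X_level_def by blast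
  show "skel (p n) y j = skel (p n) x j"
  proof (cases "j \<in> Per (p n) x")
    case True
    have y: "y (j + k * P n) = x j" for k
    proof -
      obtain l where l: "u ((j + k * P n) div P n) = z n l" using uB by blast
      have "y (j + k * P n) = x (l * P n + j mod P n)" using yv[OF l] by simp
      also have "l * P n + j mod P n = j + (l - j div P n) * int (p n)"
        using minus_div_mult_eq_mod[of j "P n"] by (simp add: algebra_simps P_def)
      also have "x \<dots> = x j" using True by (rule Per_D)
      finally show ?thesis .
    qed
    then have "j \<in> Per (p n) y" using y[of 0] by (simp add: Per_iff P_def)
    then show ?thesis using True y[of 0] by (simp add: skel_def)
  next
    case False
    then obtain k where k: "x (j + k * P n) \<noteq> x j" by (auto simp: Per_iff P_def)
    \<comment> \<open>Each value of \<open>x\<close> on the progression of \<open>j\<close> modulo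
      \<open>P n\<close> appears in \<open>y\<close> on the same progression, since the block
      carrying it is a letter that occurs in \<open>u\<close>.\<close>
    have occ: "\<exists>m. y (j + m * P n) = x (j + k * P n)" for k
    proof -
      obtain s where s: "u s = z n ((j + k * P n) div P n)"
        using letter_in_X_level[OF u] by blast
      have jm: "j + (s - j div P n) * P n = s * P n + j mod P n"
        using minus_div_mult_eq_mod[of j "P n"] by (simp add: algebra_simps)
      have "u ((s * P n + j mod P n) div P n) = z n ((j + k * P n) div P n)"
        using P_pos[of n] s by simp
      from yv[OF this] have "y (s * P n + j mod P n) = x ((j + k * P n) div P n * P n + (j + k * P n) mod P n)"
        by simp
      then have "y (j + (s - j div P n) * P n) = x (j + k * P n)"
        unfolding jm div_mult_mod_eq .
      then show ?thesis by blast
    qed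
    obtain m m' where "y (j + m * P n) = x (j + k * P n)" "y (j + m' * P n) = x j"
      using occ[of k] occ[of 0] by auto
    then have "j \<notin> Per (p n) y" using k Per_D[of j "p n" y] unfolding P_def by metis
    then show ?thesis using False by (simp add: skel_def)
  qed
qed

text \<open>Both images have the skeleton of \<open>x\<close>, so equality of their shifts makes
  \<open>k - l\<close> a period of it, hence a multiple of \<open>p n\<close>. With equal phases the
  blocks at the origin coincide, and a letter is determined by its block.\<close>

lemma ext_seq_eqD:
  assumes u: "u \<in> X_level B \<tau> n" "v \<in> X_level B \<tau> n"
    and k: "k < p n" "l < p n"
    and eq: "(shift ^^ k) (ext_seq (tau_comp \<tau> 0 n) u) = (shift ^^ l) (ext_seq (tau_comp \<tau> 0 n) v)"
  shows "k = l" "u 0 = v 0"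
proof -
  define y w where "y = ext_seq (tau_comp \<tau> 0 n) u" and "w = ext_seq (tau_comp \<tau> 0 n) v"
  have e: "(\<lambda>t. y (t + int k)) = (\<lambda>t. w (t + int l))" using eq by (simp add: funpow_shift y_def w_def)
  have "skel (p n) x (j + int k) = skel (p n) x (j + int l)" for j
    using skel_translate[of "p n" y "int k" j] skel_translate[of "p n" w "int l" j] e
      skel_ext_seq[OF u(1)] skel_ext_seq[OF u(2)] by (simp add: y_def w_def)
  from this[of "_ - int l"] have "skel (p n) x (j + (int k - int l)) = skel (p n) x j" for j
    by (simp add: algebra_simps)
  then have "int (p n) dvd int k - int l" using essential_p[of n] unfolding essential_def by blast
  then show kl: "k = l"
    using k by (metis mod_eq_dvd_iff mod_less of_nat_eq_iff of_nat_mod)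
  have yw: "y = w"
  proof
    fix t show "y t = w t" using fun_cong[OF e, of "t - int k"] kl by simp
  qed
  obtain a b where ab: "u 0 = z n a" "v 0 = z n b" using u by (auto simp: X_level_def) blast
  have "z n a = z n b"
  proof (rule z_eqI)
    fix r assume r: "0 \<le> r" "r < P n"
    have "y r = x (a * P n + r)" "w r = x (b * P n + r)"
      using ext_seq_\<tau>[OF u(1), of r a] ext_seq_\<tau>[OF u(2), of r b] r ab by (auto simp: y_def w_def)
    then show "x (a * P n + r) = x (b * P n + r)" using yw by simp
  qed
  then show "u 0 = v 0" using ab by simp
qed

lemma X_level_0: "X_level B \<tau> 0 = {y. \<forall>i j. \<exists>k. \<forall>t\<in>{i..j}. y t = x (t + k)}"
  by (simp add: X_level_z z_0)

lemma tower_subset: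
  assumes u: "u \<in> X_level B \<tau> n"
  shows "(shift ^^ k) (ext_seq (tau_comp \<tau> 0 n) u) \<in> X_level B \<tau> 0"
  unfolding X_level_0
proof (intro CollectI allI)
  fix i j :: int
  \<comment> \<open>Shifting by \<open>k\<close> and dividing by \<open>P n\<close> keeps the
    coordinates from \<open>{i..j}\<close> within \<open>{-b..b}\<close>, so one offset
    \<open>l\<close> serves the whole window.\<close>
  define b where "b = \<bar>i\<bar> + \<bar>j\<bar> + int k"
  obtain l where l: "\<And>t. t \<in> {-b..b} \<Longrightarrow> u t = z n (t + l)"
    using u unfolding X_level_z by blast
  have "(shift ^^ k) (ext_seq (tau_comp \<tau> 0 n) u) t = x (t + (int k + l * P n))" if t: "t \<in> {i..j}" for t
  proof -
    define s where "s = t + int k"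
    have s: "-b \<le> s" "s \<le> b" using t by (auto simp: b_def s_def)
    have "-b \<le> s div P n" "s div P n \<le> b"
    proof -
      have "- b * P n \<le> - b * 1" using P_pos[of n] by (intro mult_left_mono_neg) (auto simp: b_def)
      then have "- b * P n \<le> s" using s by simp
      then show "- b \<le> s div P n" using P_pos[of n] zdiv_mono1[of "- b * P n" s "P n"]
          nonzero_mult_div_cancel_right[of "P n" "-b"] by linarith
      have "b * 1 \<le> b * P n" using P_pos[of n] by (intro mult_left_mono) (auto simp: b_def)
      then have "s \<le> b * P n" using s by simp
      then show "s div P n \<le> b" using P_pos[of n] zdiv_mono1[of s "b * P n" "P n"] by simp
    qed
    then have "u (s div P n) = z n (s div P n + l)" using l by auto
    from ext_seq_\<tau>[OF u this] have "ext_seq (tau_comp \<tau> 0 n) u s = x ((s div P n + l) * P n + s mod P n)" .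
    also have "(s div P n + l) * P n + s mod P n = s + l * P n"
      by (simp add: algebra_simps)
    finally show ?thesis by (simp add: funpow_shift s_def algebra_simps)
  qed
  then show "\<exists>k'. \<forall>t\<in>{i..j}. (shift ^^ k) (ext_seq (tau_comp \<tau> 0 n) u) t = x (t + k')" by blast
qed

text \<open>Every window of \<open>y\<close> occurs in \<open>x\<close>. Offsets have finitely many
  residues modulo \<open>P n\<close> and windows are nested, so one residue serves all windows;
  cutting \<open>y\<close> along it yields \<open>u\<close>.\<close>

lemma tower_cover:
  assumes y: "y \<in> X_level B \<tau> 0"
  obtains u k where "u \<in> X_level B \<tau> n" "k < p n" "y = (shift ^^ k) (ext_seq (tau_comp \<tau> 0 n) u)"
proof -
  define occ where "occ = (\<lambda>i k. \<forall>t\<in>{-i..i}. y t = x (t + k))"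
  have "\<exists>c\<in>{0..<P n}. \<forall>i. \<exists>k. k mod P n = c \<and> occ i k"
  proof (rule ccontr)
    assume "\<not> ?thesis"
    then have "\<forall>c\<in>{0..<P n}. \<exists>i. \<forall>k. k mod P n = c \<longrightarrow> \<not> occ i k"
      by blast
    then obtain f where f: "\<forall>c\<in>{0..<P n}. \<forall>k. k mod P n = c \<longrightarrow> \<not> occ (f c) k"
      by (rule bchoice[THEN exE])
    \<comment> \<open>The largest of the windows that refute the single residues contains all of
      them, so its own offset has no possible residue.\<close>
    define i where "i = Max (f ` {0..<P n})"
    obtain k where k: "occ i k" using y unfolding X_level_0 occ_def by blast
    have c: "k mod P n \<in> {0..<P n}" using P_pos[of n] by simp
    then have "f (k mod P n) \<le> i" unfolding i_def by (intro Max_ge) auto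
    then have "occ (f (k mod P n)) k" using k by (auto simp: occ_def)
    then show False using f c by blast
  qed
  then obtain c where c: "0 \<le> c" "c < P n"
    and ck: "\<And>i. \<exists>k. k mod P n = c \<and> (\<forall>t\<in>{-i..i}. y t = x (t + k))"
    by (auto simp: occ_def)
  \<comment> \<open>One \<open>l\<close> for all blocks of a window makes the corresponding letters
    a segment of \<open>z n\<close>.\<close>
  have block: "\<exists>l. \<forall>s\<in>{-i..i}. \<forall>r\<in>{0..<P n}. y (s * P n + r - c) = x ((s + l) * P n + r)" for i
  proof -
    define b where "b = (\<bar>i\<bar> + 1) * P n"
    obtain k where k: "k mod P n = c" "\<forall>t\<in>{-b..b}. y t = x (t + k)" using ck by blast
    have "y (s * P n + r - c) = x ((s + k div P n) * P n + r)" if "s \<in> {-i..i}" "r \<in> {0..<P n}" for s r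
    proof -
      have "s * P n \<le> \<bar>i\<bar> * P n" "(- \<bar>i\<bar>) * P n \<le> s * P n"
        using that P_pos[of n] by (intro mult_right_mono; simp)+
      then have "s * P n + r - c \<in> {-b..b}"
        using that(2) c unfolding b_def distrib_right atLeastAtMost_iff atLeastLessThan_iff by linarith
      then have "y (s * P n + r - c) = x (s * P n + r - c + k)" using k by blast
      moreover have "k - c = k div P n * P n" using k(1) by (metis minus_mod_eq_div_mult)
      then have "s * P n + r - c + k = (s + k div P n) * P n + r" by (simp add: algebra_simps)
      ultimately show ?thesis by simp
    qed
    then show ?thesis by blast
  qed
  have "\<exists>l. \<forall>r\<in>{0..<P n}. y (s * P n + r - c) = x (l * P n + r)" for s
  proof -
    obtain l where "\<forall>s'\<in>{-\<bar>s\<bar>..\<bar>s\<bar>}. \<forall>r\<in>{0..<P n}. y (s' * P n + r - c) = x ((s' + l) * P n + r)"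
      using block by blast
    moreover have "s \<in> {-\<bar>s\<bar>..\<bar>s\<bar>}" by auto
    ultimately have "\<forall>r\<in>{0..<P n}. y (s * P n + r - c) = x ((s + l) * P n + r)" by blast
    then show ?thesis by blast
  qed
  then obtain g where g: "\<And>s r. r \<in> {0..<P n} \<Longrightarrow> y (s * P n + r - c) = x (g s * P n + r)"
    by metis
  define u where "u = (\<lambda>s. z n (g s))"
  have u: "u \<in> X_level B \<tau> n"
    unfolding X_level_z
  proof (intro CollectI allI)
    fix i j :: int
    define b where "b = \<bar>i\<bar> + \<bar>j\<bar>"
    obtain l where l: "\<And>s r. s \<in> {-b..b} \<Longrightarrow> r \<in> {0..<P n} \<Longrightarrow> y (s * P n + r - c) = x ((s + l) * P n + r)"
      using block by blast
    have "u t = z n (t + l)" if "t \<in> {i..j}" for t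
    proof -
      have t: "t \<in> {-b..b}" using that by (auto simp: b_def)
      show ?thesis unfolding u_def
    proof (rule z_eqI)
      fix r assume "0 \<le> r" "r < P n"
      then show "x (g t * P n + r) = x ((t + l) * P n + r)"
        using g[of r t] l[of t r] t by simp
    qed
  qed
    then show "\<exists>k. \<forall>t\<in>{i..j}. u t = z n (t + k)" by blast
  qed
  have "ext_seq (tau_comp \<tau> 0 n) u t = y (t - c)" for t
  proof -
    have "ext_seq (tau_comp \<tau> 0 n) u t = x (g (t div P n) * P n + t mod P n)"
      using u by (intro ext_seq_\<tau>) (auto simp: u_def)
    also have "\<dots> = y (t div P n * P n + t mod P n - c)"
      using P_pos[of n] by (intro g[symmetric]) auto
    finally show ?thesis by (simp only: div_mult_mod_eq)
  qed
  then have "y = (shift ^^ nat c) (ext_seq (tau_comp \<tau> 0 n) u)"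
    using c by (simp add: funpow_shift)
  then show ?thesis using that[OF u, of "nat c"] c by (simp add: P_def)
qed

lemma recognizable: "recognizable B \<tau>"
  unfolding recognizable_def
proof (intro allI conjI)
  fix n
  have len: "length (tau_comp \<tau> 0 n a) = p n" if "a \<in> B n" for a
    using that length_tau_comp_z[of 0 n] by (auto simp: Q_def P_def p_0)
  have mem: "y \<in> tower_level B \<tau> n (a, k) \<longleftrightarrow>
      (\<exists>u\<in>X_level B \<tau> n. u 0 = a \<and> y = (shift ^^ k) (ext_seq (tau_comp \<tau> 0 n) u))" for y a k
    by (auto simp: tower_level_def cylinder_def)
  have ind: "(a, k) \<in> tower_index B \<tau> n \<longleftrightarrow> a \<in> B n \<and> k < p n" for a k
    using len by (auto simp: tower_index_def)
  show disj: "disjoint_family_on (tower_level B \<tau> n) (tower_index B \<tau> n)"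
    unfolding disjoint_family_on_def
  proof (intro ballI impI)
    fix c d assume cd: "c \<in> tower_index B \<tau> n" "d \<in> tower_index B \<tau> n" "c \<noteq> d"
    obtain a k b l where ab: "c = (a, k)" "d = (b, l)" by (metis surj_pair)
    then have kl: "k < p n" "l < p n" using cd by (auto simp: ind)
    show "tower_level B \<tau> n c \<inter> tower_level B \<tau> n d = {}"
      using cd(3) ext_seq_eqD[OF _ _ kl] unfolding ab by (auto simp: mem) blast+
  qed
  show "partition_on (X_level B \<tau> 0) (tower_level B \<tau> n ` tower_index B \<tau> n)"
    unfolding partition_on_def
  proof (intro conjI equalityI subsetI)
    fix y assume "y \<in> \<Union> (tower_level B \<tau> n ` tower_index B \<tau> n)"
    then show "y \<in> X_level B \<tau> 0" using tower_subset by (auto simp: mem)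
  next
    fix y assume "y \<in> X_level B \<tau> 0"
    then obtain u k where u: "u \<in> X_level B \<tau> n" "k < p n" "y = (shift ^^ k) (ext_seq (tau_comp \<tau> 0 n) u)"
      using tower_cover by blast
    then have "y \<in> tower_level B \<tau> n (u 0, k)" by (auto simp: mem)
    moreover have "(u 0, k) \<in> tower_index B \<tau> n" using u by (auto simp: ind X_level_def)
    ultimately show "y \<in> \<Union> (tower_level B \<tau> n ` tower_index B \<tau> n)" by blast
  next
    show "disjoint (tower_level B \<tau> n ` tower_index B \<tau> n)"
      using disj by (rule disjoint_family_on_disjoint_image)
  next
    \<comment> \<open>A partition has no empty member: the translate of \<open>z n\<close> by
      \<open>i\<close> is a point of level \<open>n\<close> with \<open>z n i\<close> at the
      origin.\<close>
    have "tower_level B \<tau> n (a, k) \<noteq> {}" if "a \<in> B n" for a k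
    proof -
      obtain i where "a = z n i" using \<open>a \<in> B n\<close> by auto
      then have "(shift ^^ k) (ext_seq (tau_comp \<tau> 0 n) (\<lambda>t. z n (t + i))) \<in> tower_level B \<tau> n (a, k)"
        using z_in_X_level[of n i] unfolding mem by (intro bexI[of _ "\<lambda>t. z n (t + i)"]) auto
      then show ?thesis by blast
    qed
    moreover have "fst c \<in> B n" if "c \<in> tower_index B \<tau> n" for c
      using that by (cases c) (simp only: ind fst_conv)
    ultimately have "tower_level B \<tau> n c \<noteq> {}" if "c \<in> tower_index B \<tau> n" for c
      using that by (cases c) fastforce
    then show "{} \<notin> tower_level B \<tau> n ` tower_index B \<tau> n" by blast
  qed
qed

end

section \<open>Choice of the periods and encoding of blocks as letters\<close>

lemma toeplitz_structure_exists:
  fixes x :: "int \<Rightarrow> 'a::infinite"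
  assumes x: "toeplitz_sequence A x" and "finite A"
  shows "\<exists>p z. toeplitz_structure x p z"
proof -
  have fin: "finite (range x)" using assms finite_subset by (auto simp: toeplitz_sequence_def)
  have U: "(\<Union>p\<in>{1..}. Per p x) = UNIV" using x by (simp add: toeplitz_sequence_def)
  \<comment> \<open>First a multiple \<open>q\<close> of the current period makes the window
    periodic, then \<open>q\<close> is shrunk to an essential period with the same filled positions;
    \<open>essential_dvd\<close> keeps divisibility.\<close>
  have "\<exists>p. \<forall>n. (p n \<ge> 1 \<and> essential (p n) x \<and> (n = 0 \<longrightarrow> p n = 1)) \<and>
     (p n dvd p (Suc n) \<and> {- int (p n)..<int (p n)} \<subseteq> Per (p (Suc n)) x)"
  proof (rule dependent_nat_choice)
    show "\<exists>p. p \<ge> 1 \<and> essential p x \<and> (0 = (0::nat) \<longrightarrow> p = 1)"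
      by (intro exI[of _ 1]) (simp add: essential_def)
  next
    fix p n assume p: "p \<ge> 1 \<and> essential p x \<and> (n = (0::nat) \<longrightarrow> p = 1)"
    obtain q where q: "q \<ge> 1" "p dvd q" "{- int p..<int p} \<subseteq> Per q x"
      using Per_finite_subset[OF U, of "{- int p..<int p}" p] p by auto
    obtain p' where p': "p' \<ge> 1" "p' dvd q" "Per p' x = Per q x" "essential p' x"
      using essential_exists q(1) by blast
    then show "\<exists>p'. (p' \<ge> 1 \<and> essential p' x \<and> (Suc n = 0 \<longrightarrow> p' = 1)) \<and>
        p dvd p' \<and> {- int p..<int p} \<subseteq> Per p' x"
      using q p essential_dvd[OF _ q(2) p'(3)] by auto
  qed
  then obtain p where p: "\<And>n. p n \<ge> 1" "\<And>n. essential (p n) x" "p 0 = 1" "\<And>n. p n dvd p (Suc n)"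
     "\<And>n. {- int (p n)..<int (p n)} \<subseteq> Per (p (Suc n)) x" by auto
  \<comment> \<open>Equal consecutive periods would put a full set of residues modulo
    \<open>p n\<close> into \<open>Per (p n) x\<close> and make \<open>x\<close> periodic.\<close>
  have less: "p n < p (Suc n)" for n
  proof (rule ccontr)
    assume "\<not> ?thesis"
    moreover have "p n \<le> p (Suc n)" using p(4)[of n] p(1)[of "Suc n"] by (intro dvd_imp_le) auto
    ultimately have eq: "p (Suc n) = p n" by simp
    have "x (t + int (p n)) = x t" for t
    proof -
      define r where "r = t mod int (p n)"
      have "r \<ge> 0" "r < int (p n)" using p(1)[of n] by (auto simp: r_def)
      then have "r \<in> {- int (p n)..<int (p n)}" by auto
      then have "r \<in> Per (p n) x" using p(5)[of n] unfolding eq by blast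
      then have "x (r + (t div int (p n)) * int (p n)) = x r"
          "x (r + (t div int (p n) + 1) * int (p n)) = x r" by (rule Per_D)+
      moreover have "r + (t div int (p n)) * int (p n) = t" by (simp add: r_def)
      moreover have "r + (t div int (p n) + 1) * int (p n) = t + int (p n)"
        by (simp add: r_def algebra_simps)
      ultimately show ?thesis by simp
    qed
    then have "(shift ^^ p n) x = x" by (simp add: funpow_shift)
    then show False using x p(1)[of n] by (auto simp: toeplitz_sequence_def periodic_def)
  qed
  \<comment> \<open>The infinite letter type contains a copy of the countable set of words over
    \<open>range x\<close>, so blocks can serve as letters.\<close>
  have "countable (lists (range x))" using fin by (simp add: countable_finite)
  moreover have "\<exists>h::nat \<Rightarrow> 'a. inj h" 
    using infinite_countable_subset[OF infinite_UNIV] by auto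
  ultimately obtain enc :: "'a list \<Rightarrow> 'a" where enc: "inj_on enc (lists (range x))"
  proof -
    obtain h :: "nat \<Rightarrow> 'a" where h: "inj h" using \<open>\<exists>h::nat \<Rightarrow> 'a. inj h\<close> by blast
    have "inj_on (h \<circ> to_nat_on (lists (range x))) (lists (range x))"
      using h \<open>countable (lists (range x))\<close>
      by (intro comp_inj_on inj_on_to_nat_on) (auto intro: inj_on_subset)
    then show ?thesis using that by blast
  qed
  define W where "W = (\<lambda>n i. map (\<lambda>r. x (i * int (p n) + r)) [0..int (p n) - 1])"
  \<comment> \<open>Level \<open>0\<close> keeps the letters of \<open>x\<close>, because the
    generated subshift has to be \<open>X\<close> itself, without renaming.\<close>
  define z where "z = (\<lambda>n i. if n = 0 then x i else enc (W n i))"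
  have W: "W n i = W n j \<longleftrightarrow> (\<forall>r\<in>{0..<int (p n)}. x (i * int (p n) + r) = x (j * int (p n) + r))" for n i j
    by (auto simp: W_def)
  have z: "z n i = z n j \<longleftrightarrow> (\<forall>r\<in>{0..<int (p n)}. x (i * int (p n) + r) = x (j * int (p n) + r))" for n i j
  proof (cases "n = 0")
    case True
    have "{0..<1::int} = {0}" by auto
    then show ?thesis using True p(3) by (simp add: z_def)
  next
    case False
    have "W n i \<in> lists (range x)" for i by (auto simp: W_def)
    then have "z n i = z n j \<longleftrightarrow> W n i = W n j" using False enc by (simp add: z_def inj_on_eq_iff)
    then show ?thesis using W by simp
  qed
  have "toeplitz_structure x p z"
    by unfold_locales (use p less z fin in \<open>auto simp: z_def\<close>)
  then show ?thesis by blast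
qed

lemma toeplitz_subshift_generated:
  fixes A :: "'a::infinite set"
  assumes "alphabet A" "toeplitz_subshift A X"
  shows "\<exists>B \<tau>. directive_sequence B \<tau> \<and> constant_length_seq B \<tau> \<and> primitive_seq B \<tau> \<and>
    proper_seq B \<tau> \<and> recognizable B \<tau> \<and> generates B \<tau> X"
proof -
  obtain x where x: "toeplitz_sequence A x" "X = full_shift A closure_of orbit x"
    using assms by (auto simp: toeplitz_subshift_def)
  have "finite A" using assms(1) by (simp add: alphabet_def)
  then obtain p z where "toeplitz_structure x p z"
    using toeplitz_structure_exists[OF x(1)] by blast
  then interpret toeplitz_structure x p z .
  have "X = X_level B \<tau> 0"
    using x closure_of_orbit[OF assms(1), of x] by (simp add: toeplitz_sequence_def X_level_0)
  then show ?thesis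
    using directive constant_length_\<tau> primitive proper recognizable by (auto simp: generates_def)
qed

section \<open>Toeplitz sequences from coincidences\<close>

lemma subshift_translate:
  assumes "subshift A X" "y \<in> X"
  shows "(\<lambda>n. y (n + k)) \<in> X"
proof -
  have S: "shift ` X = X" using assms by (simp add: subshift_def)
  show ?thesis
  proof (induction k rule: int_induct[where k = 0])
    case base
    then show ?case using assms by simp
  next
    case (step1 i)
    have "shift (\<lambda>n. y (n + i)) \<in> X" using S step1 by blast
    moreover have "shift (\<lambda>n. y (n + i)) = (\<lambda>n. y (n + (i + 1)))"
      by (simp add: shift_def algebra_simps)
    ultimately show ?case by simp
  next
    case (step2 i)
    then obtain w where w: "w \<in> X" "(\<lambda>n. y (n + i)) = shift w" using S by blast
    have "w n = y (n + (i - 1))" for n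
      using fun_cong[OF w(2), of "n - 1"] by (simp add: shift_def algebra_simps)
    then have "w = (\<lambda>n. y (n + (i - 1)))" by blast
    then show ?case using w by simp
  qed
qed

lemma subshift_alphabet:
  assumes "subshift A X" "y \<in> X"
  shows "range y \<subseteq> A"
proof -
  have "X \<subseteq> {y. range y \<subseteq> A}"
    using assms closedin_subset unfolding subshift_def topspace_full_shift[symmetric] by blast
  then show ?thesis using assms by blast
qed

section \<open>Lengths, towers and coincidences at constant length\<close>

locale constant_length_directive =
  fixes B :: "nat \<Rightarrow> 'a set" and \<tau> :: "nat \<Rightarrow> 'a morphism"
  assumes directive: "directive_sequence B \<tau>" and const_len: "constant_length_seq B \<tau>"
begin

text \<open>The chosen letter is arbitrary: by \<open>length_tau_comp\<close> all images have this
  length when \<open>n \<le> N\<close>.\<close>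

definition len :: "nat \<Rightarrow> nat \<Rightarrow> nat" where
  "len n N = length (tau_comp \<tau> n N (SOME a. a \<in> B N))"

lemma B_nonempty: "B n \<noteq> {}"
  using directive by (simp add: directive_sequence_def alphabet_def)

lemma tau_comp_uniform:
  assumes "n \<le> N"
  shows "\<exists>L>0. \<forall>a\<in>B N. length (tau_comp \<tau> n N a) = L \<and> set (tau_comp \<tau> n N a) \<subseteq> B n"
  using assms
proof (induction N rule: dec_induct)
  case base
  then show ?case by auto
next
  case (step N)
  then obtain L where L: "L > 0" "\<And>a. a \<in> B N \<Longrightarrow> length (tau_comp \<tau> n N a) = L"
    "\<And>a. a \<in> B N \<Longrightarrow> set (tau_comp \<tau> n N a) \<subseteq> B n" by blast
  obtain b where b: "b \<in> B (Suc N)" using B_nonempty by blast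
  have \<tau>: "set (\<tau> N a) \<subseteq> B N" "\<tau> N a \<noteq> []" "length (\<tau> N a) = length (\<tau> N b)" if "a \<in> B (Suc N)" for a
  proof -
    have "nonerasing_morphism (B (Suc N)) (B N) (\<tau> N)" "constant_length (B (Suc N)) (\<tau> N)"
      using directive const_len by (auto simp: directive_sequence_def constant_length_seq_def)
    then show "set (\<tau> N a) \<subseteq> B N" "\<tau> N a \<noteq> []" "length (\<tau> N a) = length (\<tau> N b)"
      using that b unfolding nonerasing_morphism_def constant_length_def in_lists_conv_set by blast+
  qed
  have eq: "tau_comp \<tau> n (Suc N) a = ext_word (tau_comp \<tau> n N) (\<tau> N a)" for a
    using step.hyps by (subst tau_comp_split[of _ N]) auto
  have "length (tau_comp \<tau> n (Suc N) a) = L * length (\<tau> N b)"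
    if "a \<in> B (Suc N)" for a
    using \<tau>(1,3)[OF that] L(2) unfolding eq by (subst length_ext_word[of _ _ L]) auto
  moreover have "set (tau_comp \<tau> n (Suc N) a) \<subseteq> B n" if "a \<in> B (Suc N)" for a
    using \<tau>(1)[OF that] L(3) unfolding eq ext_word_def by auto
  moreover have "L * length (\<tau> N b) > 0" using L(1) \<tau>(2)[OF b] by simp
  ultimately show ?case by blast
qed

lemma length_tau_comp: "n \<le> N \<Longrightarrow> a \<in> B N \<Longrightarrow> length (tau_comp \<tau> n N a) = len n N"
proof -
  assume "n \<le> N" and a: "a \<in> B N"
  then obtain L where L: "\<And>b. b \<in> B N \<Longrightarrow> length (tau_comp \<tau> n N b) = L"
    using tau_comp_uniform by blast
  have "(SOME a. a \<in> B N) \<in> B N" using a by (rule someI)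
  then show ?thesis using L a by (simp add: len_def)
qed

lemma set_tau_comp: "n \<le> N \<Longrightarrow> a \<in> B N \<Longrightarrow> set (tau_comp \<tau> n N a) \<subseteq> B n"
  using tau_comp_uniform[of n N] by blast

lemma len_pos: "n \<le> N \<Longrightarrow> len n N > 0"
  using tau_comp_uniform[of n N] length_tau_comp[of n N] B_nonempty[of N] by force

lemma nth_in: "n \<le> N \<Longrightarrow> a \<in> B N \<Longrightarrow> q < len n N \<Longrightarrow> tau_comp \<tau> n N a ! q \<in> B n"
  using set_tau_comp[of n N a] length_tau_comp[of n N a] by (metis nth_mem subsetD)

lemma len_trans:
  assumes "n \<le> M" "M \<le> N"
  shows "len n N = len n M * len M N"
proof -
  obtain a where a: "a \<in> B N" using B_nonempty by blast
  have "length (tau_comp \<tau> n N a) = len n M * length (tau_comp \<tau> M N a)"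
    using assms set_tau_comp[OF assms(2) a] unfolding tau_comp_split[OF assms]
    by (intro length_ext_word length_tau_comp) auto
  then show ?thesis using a assms by (simp add: length_tau_comp)
qed

lemma len_same [simp]: "len n n = 1"
  by (simp add: len_def)

lemma nth_tau_comp:
  assumes "n \<le> M" "M \<le> N" "a \<in> B N" "q < len M N" "r < len n M"
  shows "tau_comp \<tau> n N a ! (q * len n M + r) = tau_comp \<tau> n M (tau_comp \<tau> M N a ! q) ! r"
  unfolding tau_comp_split[OF assms(1,2)]
  using assms set_tau_comp[OF assms(2,3)]
  by (intro nth_ext_word length_tau_comp) (auto simp: length_tau_comp)

lemma len_index:
  assumes "n \<le> M" "M \<le> N" "q < len M N" "r < len n M"
  shows "q * len n M + r < len n N"
proof -
  have "(q + 1) * len n M \<le> len M N * len n M" using assms by (intro mult_le_mono) auto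
  then show ?thesis using assms len_trans[OF assms(1,2)] by (simp add: algebra_simps)
qed

text \<open>Morphisms of length \<open>1\<close> are allowed, so growth has to come from the points:
  a window of any size lies in the image of one letter.\<close>

lemma len_unbounded:
  assumes "X_level B \<tau> 0 \<noteq> {}"
  shows "\<exists>N>n. b \<le> len n N"
proof -
  obtain y where y: "y \<in> X_level B \<tau> 0" using assms by blast
  obtain N a k where N: "a \<in> B N" "\<forall>t\<in>{0..int (b * len 0 n)}. 0 \<le> t + k \<and>
       t + k < int (length (tau_comp \<tau> 0 N a)) \<and> tau_comp \<tau> 0 N a ! nat (t + k) = y t"
    using y unfolding X_level_iff[OF B_nonempty] by blast
  have "b * len 0 n \<le> len 0 N"
  proof -
    have "0 \<le> k" "int (b * len 0 n) + k < int (length (tau_comp \<tau> 0 N a))"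
      using N(2)[rule_format, of "0"] N(2)[rule_format, of "int (b * len 0 n)"] by simp_all
    then show ?thesis using length_tau_comp[OF _ N(1), of 0] by linarith
  qed
  \<comment> \<open>\<open>N\<close> need not exceed \<open>n\<close>; a larger level only lengthens
    images, and the factor \<open>len 0 n\<close> cancels.\<close>
  define N' where "N' = max N (Suc n)"
  have "len 0 N' = len 0 N * len N N'" by (intro len_trans) (auto simp: N'_def)
  moreover have "len N N' > 0" by (intro len_pos) (auto simp: N'_def)
  ultimately have "len 0 N \<le> len 0 N'" by simp
  moreover have "len 0 N' = len 0 n * len n N'" by (intro len_trans) (auto simp: N'_def)
  ultimately have "b * len 0 n \<le> len n N' * len 0 n"
    using \<open>b * len 0 n \<le> len 0 N\<close> by (metis le_trans mult.commute)
  then have "b \<le> len n N'" using len_pos[of 0 n] by (intro mult_right_le_imp_le[of b "len 0 n"]) simp_all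
  then show ?thesis by (intro exI[of _ N']) (auto simp: N'_def)
qed

text \<open>In a tower higher than \<open>q\<close>, \<open>shift ^^ q\<close> carries floor
  \<open>0\<close> into floor \<open>q\<close>, which is disjoint from it.\<close>

lemma not_all_periodic:
  assumes rec: "recognizable B \<tau>" and ne: "X_level B \<tau> 0 \<noteq> {}" and "q \<ge> 1"
  shows "\<exists>y\<in>X_level B \<tau> 0. (shift ^^ q) y \<noteq> y"
proof -
  obtain n where n: "Suc q \<le> len 0 n" using len_unbounded[OF ne] by blast
  obtain a where a: "a \<in> B n" using B_nonempty by blast
  have rn: "disjoint_family_on (tower_level B \<tau> n) (tower_index B \<tau> n)"
     "partition_on (X_level B \<tau> 0) (tower_level B \<tau> n ` tower_index B \<tau> n)"
    using rec by (auto simp: recognizable_def)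
  have ind: "(a, 0) \<in> tower_index B \<tau> n" "(a, q) \<in> tower_index B \<tau> n"
    using n a by (auto simp: tower_index_def length_tau_comp)
  then have "tower_level B \<tau> n (a, 0) \<noteq> {}" "tower_level B \<tau> n (a, 0) \<subseteq> X_level B \<tau> 0"
    using rn(2) unfolding partition_on_def by (metis imageI, blast)
  then obtain y where y: "y \<in> tower_level B \<tau> n (a, 0)" "y \<in> X_level B \<tau> 0" by blast
  then have "(shift ^^ q) y \<in> tower_level B \<tau> n (a, q)" by (auto simp: tower_level_def)
  moreover have "tower_level B \<tau> n (a, 0) \<inter> tower_level B \<tau> n (a, q) = {}"
    using rn(1) ind assms(3) by (auto simp: disjoint_family_on_def)
  ultimately show ?thesis using y by (metis IntI empty_iff)
qed

text \<open>Properness starts at index \<open>1\<close>, so each pair is chosen with the proper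
  morphism at the odd index \<open>2 * k + 1\<close> applied first. All composed images then begin
  with the image of its common first letter \<open>c\<close>.\<close>

lemma proper_has_coincidences:
  assumes "proper_seq B \<tau>"
  shows "has_coincidences B \<tau>"
  unfolding has_coincidences_def
proof (intro exI conjI allI)
  show "is_contraction B \<tau> (\<lambda>k. B (2 * k)) (\<lambda>k. tau_comp \<tau> (2 * k) (2 * Suc k))"
    unfolding is_contraction_def by (intro exI[of _ "\<lambda>k. 2 * k"]) (auto simp: strict_mono_def)
next
  fix k :: nat
  define M where "M = 2 * k + 1"
  have S: "2 * Suc k = Suc M" by (simp add: M_def)
  have le: "2 * k \<le> M" "M \<le> Suc M" by (auto simp: M_def)
  have "M \<ge> 1" by (simp add: M_def)
  then obtain c where c: "\<And>a. a \<in> B (Suc M) \<Longrightarrow> \<tau> M a \<noteq> [] \<and> hd (\<tau> M a) = c"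
    using assms unfolding proper_seq_def proper_morphism_def by blast
  have "tau_comp \<tau> (2 * k) (Suc M) a ! 0 = tau_comp \<tau> (2 * k) M c ! 0" if a: "a \<in> B (Suc M)" for a
    using nth_tau_comp[OF le a, of 0 0] len_pos[OF le(1)] len_pos[OF le(2)] c[OF a]
    by (auto simp: hd_conv_nth)
  moreover have "morphism_length (B (Suc M)) (tau_comp \<tau> (2 * k) (Suc M)) > 0"
  proof -
    have "morphism_length (B (Suc M)) (tau_comp \<tau> (2 * k) (Suc M)) = len (2 * k) (Suc M)"
      unfolding morphism_length_def
      using B_nonempty[of "Suc M"] le by (intro the_equality) (auto simp: length_tau_comp)
    then show ?thesis using len_pos[of "2 * k" "Suc M"] le by simp
  qed
  ultimately have "0 \<in> coinc (B (2 * Suc k)) (tau_comp \<tau> (2 * k) (2 * Suc k))"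
    unfolding coinc_def S by simp
  then show "coinc (B (2 * Suc k)) (tau_comp \<tau> (2 * k) (2 * Suc k)) \<noteq> {}" by blast
qed

text \<open>A coincidence of a later morphism turns a whole block into coincidences; an interior position
  of that block is at positive distance from both ends.\<close>

lemma interior_coincidence:
  assumes coin: "has_coincidences B \<tau>" and ne: "X_level B \<tau> 0 \<noteq> {}"
  shows "\<exists>N>n. \<exists>i. \<exists>c\<in>B n. 0 < i \<and> i + 1 < len n N \<and> (\<forall>a\<in>B N. tau_comp \<tau> n N a ! i = c)"
proof -
  obtain m where m: "strict_mono m"
      "\<And>k. coinc (B (m (Suc k))) (tau_comp \<tau> (m k) (m (Suc k))) \<noteq> {}"
    using coin unfolding has_coincidences_def is_contraction_def by blast
  \<comment> \<open>Length \<open>3\<close> is the least with an interior position.\<close>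
  obtain N0 where N0: "N0 > n" "3 \<le> len n N0" using len_unbounded[OF ne] by blast
  define M N where "M = m N0" and "N = m (Suc N0)"
  have M: "N0 \<le> M" using m(1) by (simp add: M_def seq_suble)
  have MN: "M < N" using m(1) by (simp add: M_def N_def strict_mono_def)
  have "len n M = len n N0 * len N0 M" using N0 M by (intro len_trans) auto
  moreover have "len N0 M \<ge> 1" using len_pos[OF M] by simp
  ultimately have "3 * 1 \<le> len n M" using N0(2) by (simp only: mult_le_mono)
  then have len: "3 \<le> len n M" by simp
  obtain j where j: "j < morphism_length (B N) (tau_comp \<tau> M N)"
      "\<And>a b. a \<in> B N \<Longrightarrow> b \<in> B N \<Longrightarrow> tau_comp \<tau> M N a ! j = tau_comp \<tau> M N b ! j"
    using m(2)[of N0] unfolding coinc_def M_def N_def by blast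
  have "morphism_length (B N) (tau_comp \<tau> M N) = len M N"
    unfolding morphism_length_def using B_nonempty[of N] MN
    by (intro the_equality) (auto simp: length_tau_comp)
  then have jlt: "j < len M N" using j(1) by simp
  obtain b where b: "b \<in> B N" using B_nonempty by blast
  define d where "d = tau_comp \<tau> M N b ! j"
  have d: "d \<in> B M" unfolding d_def using jlt b MN by (intro nth_in) auto
  \<comment> \<open>The coincidence at \<open>j\<close> makes block number \<open>j\<close> the
    image of one letter \<open>d\<close>; offset \<open>1\<close> in it is interior, as offset
    \<open>2\<close> still exists.\<close>
  define i where "i = j * len n M + 1"
  have le: "n \<le> M" "M \<le> N" using N0 M MN by auto
  have val: "tau_comp \<tau> n N a ! i = tau_comp \<tau> n M d ! 1" if a: "a \<in> B N" for a
    using nth_tau_comp[OF le a jlt, of 1] len j(2)[OF a b] by (simp add: i_def d_def)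
  have "i + 1 < len n N" using len_index[OF le jlt, of 2] len by (simp add: i_def)
  moreover have "tau_comp \<tau> n M d ! 1 \<in> B n" using le d len by (intro nth_in) auto
  ultimately show ?thesis using val le MN by (intro exI[of _ N]) (auto simp: i_def)
qed

end

text \<open>The words \<open>\<tau>\<^bsub>[0,N k)\<^esub>(c k)\<close>, placed with their first letter at coordinate \<open>- m k\<close>, extend each
  other in both directions, and define the Toeplitz sequence.\<close>

locale coincidence_tower = constant_length_directive +
  fixes N :: "nat \<Rightarrow> nat" and i :: "nat \<Rightarrow> nat" and c :: "nat \<Rightarrow> 'a"
  assumes N_0: "N 0 = 0" and N_less: "N k < N (Suc k)"
    and i_pos: "0 < i k" and i_less: "i k + 1 < len (N k) (N (Suc k))"
    and c_in: "c k \<in> B (N k)"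
    and coincidence: "a \<in> B (N (Suc k)) \<Longrightarrow> tau_comp \<tau> (N k) (N (Suc k)) a ! i k = c k"
begin

definition H :: "nat \<Rightarrow> nat" where "H k = len 0 (N k)"

text \<open>\<open>c k\<close> has index \<open>i k\<close> in every image of a letter of level
  \<open>N (Suc k)\<close>, so \<open>W k\<close> begins \<open>i k * H k\<close> places after the
  start of \<open>W (Suc k)\<close>; the recursion adds up these offsets.\<close>

fun m :: "nat \<Rightarrow> nat" where
  "m 0 = 0"
| "m (Suc k) = m k + i k * H k"

definition W :: "nat \<Rightarrow> 'a list" where "W k = tau_comp \<tau> 0 (N k) (c k)"

definition covers :: "nat \<Rightarrow> int \<Rightarrow> bool" where
  "covers k t \<longleftrightarrow> 0 \<le> t + int (m k) \<and> t + int (m k) < int (H k)"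

text \<open>By \<open>x_W\<close> every level covering \<open>t\<close> gives the same value; level
  \<open>nat \<bar>t\<bar>\<close> always covers \<open>t\<close>.\<close>

definition x :: "int \<Rightarrow> 'a" where "x t = W (nat \<bar>t\<bar>) ! nat (t + int (m (nat \<bar>t\<bar>)))"

lemma N_mono: "k \<le> l \<Longrightarrow> N k \<le> N l"
  using N_less by (simp add: lift_Suc_mono_le less_imp_le)

lemma N_ge: "k \<le> N k"
  using N_less by (simp add: seq_suble strict_mono_Suc_iff)

lemma H_pos: "H k > 0" by (simp add: H_def len_pos)

lemma H_trans: "k \<le> l \<Longrightarrow> H l = H k * len (N k) (N l)"
  unfolding H_def by (intro len_trans N_mono) auto

lemma H_Suc: "(i k + 2) * H k \<le> H (Suc k)"
proof -
  have "(i k + 2) * H k \<le> len (N k) (N (Suc k)) * H k"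
    using i_less[of k] by (intro mult_le_mono) auto
  then show ?thesis using H_trans[of k "Suc k"] by (simp add: mult.commute)
qed

text \<open>At each level \<open>i_pos\<close> adds a place on the left and \<open>i_less\<close>
  leaves a further block on the right, so the words exhaust the integers in both directions.\<close>

lemma m_bounds: "k \<le> m k" "m k + k < H k"
proof (induction k)
  case 0
  { case 1 then show ?case by simp next case 2 then show ?case using H_pos by simp }
next
  case (Suc k)
  have "1 * 1 \<le> i k * H k" using i_pos[of k] H_pos[of k] by (intro mult_le_mono) auto
  { case 1 then show ?case using Suc.IH \<open>1 * 1 \<le> i k * H k\<close> unfolding m.simps by linarith
  next
    case 2
    then show ?case using Suc.IH H_Suc[of k] H_pos[of k] by (simp add: algebra_simps) }
qed

lemma covers: "\<bar>t\<bar> \<le> int k \<Longrightarrow> covers k t"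
  using m_bounds[of k] by (auto simp: covers_def)

lemma m_trans: "k \<le> l \<Longrightarrow> \<exists>D. m l = m k + D * H k"
proof (induction l rule: dec_induct)
  case base
  then show ?case by (intro exI[of _ 0]) simp
next
  case (step l)
  then obtain D where D: "m l = m k + D * H k" by blast
  have "m (Suc l) = m k + (D + i l * len (N k) (N l)) * H k"
    using D H_trans[OF step.hyps(1)] by (simp add: algebra_simps)
  then show ?case by blast
qed

text \<open>Block number \<open>D\<close> of \<open>W l\<close> is the image of some letter
  \<open>b\<close> of level \<open>N (Suc k)\<close>, and the coincidence at \<open>i k\<close> puts
  \<open>W k\<close> at the same place in it whatever \<open>b\<close> is.\<close>

lemma nth_W:
  assumes "Suc k \<le> l" "D < len (N (Suc k)) (N l)" "r < H k"
  shows "W l ! (D * H (Suc k) + (i k * H k + r)) = W k ! r"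
    and "D * H (Suc k) + (i k * H k + r) < H l"
proof -
  have le: "N k \<le> N (Suc k)" "N (Suc k) \<le> N l" "0 \<le> N k" "0 \<le> N (Suc k)" using N_mono assms(1) by auto
  have il: "i k < len (N k) (N (Suc k))" using i_less[of k] by simp
  have r: "r < len 0 (N k)" using assms by (simp add: H_def)
  have s: "i k * H k + r < len 0 (N (Suc k))"
    unfolding H_def by (rule len_index) (use le il r in auto)
  show "D * H (Suc k) + (i k * H k + r) < H l"
    using len_index[OF le(4,2) assms(2) s] by (simp add: H_def)
  define b where "b = tau_comp \<tau> (N (Suc k)) (N l) (c l) ! D"
  have b: "b \<in> B (N (Suc k))" unfolding b_def using le(2) c_in assms(2) by (rule nth_in)
  have "W l ! (D * H (Suc k) + (i k * H k + r)) = tau_comp \<tau> 0 (N (Suc k)) b ! (i k * H k + r)"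
    unfolding W_def H_def[of "Suc k"] b_def
    using le c_in assms(2) s by (intro nth_tau_comp) auto
  also have "\<dots> = tau_comp \<tau> 0 (N k) (tau_comp \<tau> (N k) (N (Suc k)) b ! i k) ! r"
    unfolding H_def using le b il r by (intro nth_tau_comp) auto
  finally show "W l ! (D * H (Suc k) + (i k * H k + r)) = W k ! r"
    by (simp add: coincidence[OF b] W_def)
qed

lemma covers_Suc:
  assumes "covers k t"
  shows "covers (Suc k) t" "W (Suc k) ! nat (t + int (m (Suc k))) = W k ! nat (t + int (m k))"
proof -
  define r where "r = nat (t + int (m k))"
  have r: "r < H k" "int r = t + int (m k)" using assms by (auto simp: covers_def r_def)
  have p: "nat (t + int (m (Suc k))) = 0 * H (Suc k) + (i k * H k + r)"
    using r(2) unfolding m.simps by linarith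
  note * = nth_W[of k "Suc k" 0 r]
  show "W (Suc k) ! nat (t + int (m (Suc k))) = W k ! nat (t + int (m k))"
    unfolding p using *(1) r(1) by (simp add: r_def)
  have "i k * H k + r < H (Suc k)" using *(2) r(1) by simp
  then show "covers (Suc k) t"
    using r(2) unfolding covers_def m.simps by linarith
qed

lemma covers_mono:
  assumes "k \<le> l" "covers k t"
  shows "covers l t \<and> W l ! nat (t + int (m l)) = W k ! nat (t + int (m k))"
  using assms by (induction l rule: dec_induct) (auto simp: covers_Suc simp del: m.simps)

lemma x_W: "covers k t \<Longrightarrow> x t = W k ! nat (t + int (m k))"
  using covers_mono[of k "nat \<bar>t\<bar>" t] covers_mono[of "nat \<bar>t\<bar>" k t] covers[of t "nat \<bar>t\<bar>"]
  unfolding x_def by (cases "k \<le> nat \<bar>t\<bar>") auto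

lemma length_W: "length (W k) = H k"
  by (simp add: W_def H_def length_tau_comp c_in)

text \<open>A translate of \<open>t\<close> by a multiple of \<open>H (Suc k)\<close> lies at the
  same place of another block in a longer word \<open>W l\<close>, where \<open>nth_W\<close> finds
  the same letter of \<open>W k\<close>.\<close>

lemma x_periodic:
  assumes t: "covers k t"
  shows "x (t + j * int (H (Suc k))) = x t"
proof -
  define r where "r = nat (t + int (m k))"
  have r: "r < H k" "int r = t + int (m k)" using t by (auto simp: covers_def r_def)
  define t' where "t' = t + j * int (H (Suc k))"
  define l where "l = max (Suc k) (nat \<bar>t'\<bar>)"
  have l: "covers l t'" by (intro covers) (auto simp: l_def)
  have kl: "Suc k \<le> l" by (simp add: l_def)
  obtain D where D: "m l = m (Suc k) + D * H (Suc k)" using m_trans[OF kl] by blast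
  define L where "L = len (N (Suc k)) (N l)"
  have HL: "int (H l) = int L * int (H (Suc k))" using H_trans[OF kl] by (simp add: L_def mult.commute)
  have s: "i k * H k + r < H (Suc k)" using nth_W(2)[of k "Suc k" 0 r] r by simp
  have pos: "t' + int (m l) = (j + int D) * int (H (Suc k)) + int (i k * H k + r)"
    by (simp add: t'_def D r(2) algebra_simps)
  \<comment> \<open>Since \<open>W l\<close> covers \<open>t'\<close>, the block containing
    \<open>t'\<close> is one of the \<open>L\<close> blocks of \<open>W l\<close>.\<close>
  have "j + int D \<ge> 0"
  proof (rule ccontr)
    assume "\<not> ?thesis"
    then have "(j + int D) * int (H (Suc k)) \<le> (- 1) * int (H (Suc k))" by (intro mult_right_mono) auto
    then show False using l pos s unfolding covers_def by linarith
  qed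
  moreover have "j + int D < int L"
  proof (rule ccontr)
    assume "\<not> ?thesis"
    then have "int L * int (H (Suc k)) \<le> (j + int D) * int (H (Suc k))" by (intro mult_right_mono) auto
    then show False using l pos HL unfolding covers_def by linarith
  qed
  ultimately obtain D' where D': "int D' = j + int D" "D' < L" by (metis nonneg_int_cases of_nat_less_iff)
  have "t' + int (m l) = int (D' * H (Suc k) + (i k * H k + r))" using pos D' by simp
  then have "nat (t' + int (m l)) = D' * H (Suc k) + (i k * H k + r)" by linarith
  then have "x t' = W k ! r" using x_W[OF l] nth_W(1)[OF kl, of D' r] D' r by (simp add: L_def)
  then show ?thesis using x_W[OF t] by (simp add: t'_def r_def)
qed

lemma x_in_X_level: "x \<in> X_level B \<tau> 0"
  unfolding X_level_iff[OF B_nonempty]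
proof (intro conjI allI)
  show "range x \<subseteq> B 0"
  proof clarify
    fix t
    define k where "k = nat \<bar>t\<bar>"
    have k: "covers k t" by (intro covers) (simp add: k_def)
    have "W k ! nat (t + int (m k)) \<in> B 0"
      unfolding W_def using k c_in by (intro nth_in) (auto simp: covers_def H_def)
    then show "x t \<in> B 0" using x_W[OF k] by simp
  qed
next
  fix a b
  define k where "k = Suc (nat (max \<bar>a\<bar> \<bar>b\<bar>))"
  have "0 \<le> t + int (m k) \<and> t + int (m k) < int (length (tau_comp \<tau> 0 (N k) (c k))) \<and>
      tau_comp \<tau> 0 (N k) (c k) ! nat (t + int (m k)) = x t" if "t \<in> {a..b}" for t
  proof -
    have k: "covers k t" using that by (intro covers) (auto simp: k_def)
    then show ?thesis using x_W[OF k] length_W[of k] by (simp add: covers_def W_def)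
  qed
  moreover have "0 < N k" using N_ge[of k] by (simp add: k_def)
  ultimately show "\<exists>N>0. \<exists>d\<in>B N. \<exists>k. \<forall>t\<in>{a..b}. 0 \<le> t + k \<and>
       t + k < int (length (tau_comp \<tau> 0 N d)) \<and> tau_comp \<tau> 0 N d ! nat (t + k) = x t"
    using c_in by blast
qed

text \<open>A window of \<open>y\<close> lies in the image of a letter \<open>a\<close>. By
  primitivity \<open>a\<close> occurs in the images of all letters of some level \<open>M\<close>,
  and \<open>W k\<close> is made of such images once \<open>N k \<ge> M\<close>.\<close>

lemma x_dense:
  assumes prim: "primitive_seq B \<tau>" and y: "y \<in> X_level B \<tau> 0"
  shows "\<exists>k. \<forall>t\<in>{l..j}. y t = x (t + k)"
proof -
  obtain n a k0 where n: "a \<in> B n" and k0: "\<And>t. t \<in> {l..j} \<Longrightarrow> 0 \<le> t + k0 \<and>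
       t + k0 < int (length (tau_comp \<tau> 0 n a)) \<and> tau_comp \<tau> 0 n a ! nat (t + k0) = y t"
  proof -
    have "\<exists>n>0. \<exists>a\<in>B n. \<exists>k. \<forall>t\<in>{l..j}. 0 \<le> t + k \<and>
       t + k < int (length (tau_comp \<tau> 0 n a)) \<and> tau_comp \<tau> 0 n a ! nat (t + k) = y t"
      using y unfolding X_level_iff[OF B_nonempty] by (elim conjE allE)
    then show ?thesis using that by blast
  qed
  obtain M where M: "M > n" "\<And>b. b \<in> B M \<Longrightarrow> B n \<subseteq> set (tau_comp \<tau> n M b)"
    using prim unfolding primitive_seq_def by blast
  define k where "k = M"
  have Mk: "M \<le> N k" using N_ge by (simp add: k_def)
  define b where "b = tau_comp \<tau> M (N k) (c k) ! 0"
  have b: "b \<in> B M" unfolding b_def using Mk c_in len_pos by (intro nth_in) auto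
  have nM: "n \<le> M" using M by simp
  obtain s where s: "s < len n M" "tau_comp \<tau> n M b ! s = a"
    using M(2)[OF b] n length_tau_comp[OF nM b] by (metis in_set_conv_nth subsetD)
  have W: "W k ! (s * len 0 n + r) = tau_comp \<tau> 0 n a ! r \<and> s * len 0 n + r < H k" if r: "r < len 0 n" for r
  proof -
    have lt: "s * len 0 n + r < len 0 M" using nM s r by (intro len_index) auto
    have "W k ! (0 * len 0 M + (s * len 0 n + r)) = tau_comp \<tau> 0 M b ! (s * len 0 n + r)"
      unfolding W_def b_def using Mk c_in len_pos lt by (intro nth_tau_comp) auto
    also have "\<dots> = tau_comp \<tau> 0 n (tau_comp \<tau> n M b ! s) ! r"
      using nM b s r by (intro nth_tau_comp) auto
    finally have "W k ! (s * len 0 n + r) = tau_comp \<tau> 0 n a ! r" using s by simp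
    moreover have "0 * len 0 M + (s * len 0 n + r) < H k"
      unfolding H_def by (rule len_index) (use Mk len_pos[OF Mk] lt in auto)
    ultimately show ?thesis by simp
  qed
  \<comment> \<open>The image of \<open>a\<close> starts at position \<open>s * len 0 n\<close> of
    \<open>W k\<close>, and \<open>W k\<close> starts at coordinate \<open>- m k\<close> of
    \<open>x\<close>.\<close>
  have "y t = x (t + (k0 + int (s * len 0 n) - int (m k)))" if t: "t \<in> {l..j}" for t
  proof -
    define r where "r = nat (t + k0)"
    have r: "int r = t + k0" "r < len 0 n" "tau_comp \<tau> 0 n a ! r = y t"
      using k0[OF t] n by (auto simp: r_def length_tau_comp)
    define t' where "t' = t + (k0 + int (s * len 0 n) - int (m k))"
    have t': "t' + int (m k) = int (s * len 0 n + r)" using r by (simp add: t'_def)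
    then have "covers k t'" unfolding covers_def using W[OF r(2)] by linarith
    then have "x t' = W k ! (s * len 0 n + r)" using x_W t' by (metis nat_int)
    then show ?thesis using W[OF r(2)] r by (simp add: t'_def)
  qed
  then show ?thesis by blast
qed

lemma toeplitz:
  assumes "alphabet A" "subshift A (X_level B \<tau> 0)" "primitive_seq B \<tau>" "recognizable B \<tau>"
  shows "toeplitz_subshift A (X_level B \<tau> 0)"
proof -
  have xA: "range x \<subseteq> A" using subshift_alphabet[OF assms(2) x_in_X_level] .
  have X: "X_level B \<tau> 0 = full_shift A closure_of orbit x"
  proof
    show "full_shift A closure_of orbit x \<subseteq> X_level B \<tau> 0"
      using assms(2) subshift_translate[OF assms(2) x_in_X_level]
      by (intro closure_of_minimal) (auto simp: subshift_def orbit_def)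
    show "X_level B \<tau> 0 \<subseteq> full_shift A closure_of orbit x"
      unfolding closure_of_orbit[OF assms(1) xA] using x_dense[OF assms(3)] by blast
  qed
  have "\<not> periodic x"
  proof
    assume "periodic x"
    then obtain q where q: "q \<ge> 1" "(shift ^^ q) x = x" by (auto simp: periodic_def)
    obtain y where y: "y \<in> X_level B \<tau> 0" "(shift ^^ q) y \<noteq> y"
      using not_all_periodic[OF assms(4) _ q(1)] x_in_X_level by blast
    \<comment> \<open>By density a period of \<open>x\<close> is a period of every point of
      \<open>X\<close>: the window \<open>{t..t + int q}\<close> contains both coordinates.\<close>
    have "y (t + int q) = y t" for t
    proof -
      obtain k where "\<And>s. s \<in> {t..t + int q} \<Longrightarrow> y s = x (s + k)"
        using x_dense[OF assms(3) y(1)] by blast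
      then have "y t = x (t + k)" "y (t + int q) = x (t + int q + k)" by auto
      moreover have "x (t + k + int q) = x (t + k)"
        using fun_cong[OF q(2)] by (simp add: funpow_shift)
      ultimately show ?thesis by (simp add: algebra_simps)
    qed
    then show False using y(2) by (simp add: funpow_shift)
  qed
  moreover have "t \<in> (\<Union>p\<in>{1..}. Per p x)" for t
  proof -
    have "covers (nat \<bar>t\<bar>) t" by (intro covers) simp
    then have "t \<in> Per (H (Suc (nat \<bar>t\<bar>))) x"
      using x_periodic unfolding Per_def constant_on_def by blast
    then show ?thesis using H_pos[of "Suc (nat \<bar>t\<bar>)"] by (intro UN_I) auto
  qed
  ultimately have "toeplitz_sequence A x" using xA by (auto simp: toeplitz_sequence_def)
  then show ?thesis using X unfolding toeplitz_subshift_def by blast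
qed

end

section \<open>The two equivalences\<close>

lemma coincidences_toeplitz_subshift:
  assumes A: "alphabet A" "subshift A X"
    and \<tau>: "directive_sequence B \<tau>" "constant_length_seq B \<tau>" "primitive_seq B \<tau>"
      "recognizable B \<tau>" "has_coincidences B \<tau>" "generates B \<tau> X"
  shows "toeplitz_subshift A X"
proof -
  interpret constant_length_directive B \<tau> using \<tau> by unfold_locales
  have X: "X = X_level B \<tau> 0" using \<tau> by (simp add: generates_def)
  have ne: "X_level B \<tau> 0 \<noteq> {}" using A X by (simp add: subshift_def)
  have "\<forall>n. \<exists>N i c. N > n \<and> c \<in> B n \<and> 0 < i \<and> i + 1 < len n N \<and> (\<forall>a\<in>B N. tau_comp \<tau> n N a ! i = c)"
    using interior_coincidence[OF \<tau>(5) ne] by blast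
  then obtain f g h where f: "\<And>n. f n > n \<and> h n \<in> B n \<and> 0 < g n \<and> g n + 1 < len n (f n) \<and>
      (\<forall>a\<in>B (f n). tau_comp \<tau> n (f n) a ! g n = h n)" by metis
  \<comment> \<open>Iterating the choice \<open>f\<close> from level \<open>0\<close> stacks the
    interior coincidences into a tower.\<close>
  define N where "N = (\<lambda>k. (f ^^ k) 0)"
  interpret coincidence_tower B \<tau> N "\<lambda>k. g (N k)" "\<lambda>k. h (N k)"
    using f by unfold_locales (auto simp: N_def)
  show ?thesis unfolding X using A \<tau> X by (intro toeplitz) auto
qed

lemma proper_coincidences:
  assumes "directive_sequence B \<tau>" "constant_length_seq B \<tau>" "proper_seq B \<tau>"
  shows "has_coincidences B \<tau>"
proof -
  interpret constant_length_directive B \<tau> using assms by unfold_locales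
  show ?thesis using assms(3) by (rule proper_has_coincidences)
qed

theorem proposition7:
  fixes A :: "'a::infinite set" and X :: "(int \<Rightarrow> 'a) set"
  assumes "alphabet A" and "subshift A X"
  shows
    "(toeplitz_subshift A X \<longleftrightarrow>
       (\<exists>B \<tau>. directive_sequence B \<tau> \<and> constant_length_seq B \<tau> \<and> primitive_seq B \<tau> \<and>
              proper_seq B \<tau> \<and> recognizable B \<tau> \<and> generates B \<tau> X)) \<and>
     (toeplitz_subshift A X \<longleftrightarrow>
       (\<exists>B \<tau>. directive_sequence B \<tau> \<and> constant_length_seq B \<tau> \<and> primitive_seq B \<tau> \<and>
              recognizable B \<tau> \<and> has_coincidences B \<tau> \<and> generates B \<tau> X))"
proof (intro conjI iffI)
  assume "toeplitz_subshift A X"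
  then show "\<exists>B \<tau>. directive_sequence B \<tau> \<and> constant_length_seq B \<tau> \<and> primitive_seq B \<tau> \<and>
      proper_seq B \<tau> \<and> recognizable B \<tau> \<and> generates B \<tau> X"
    by (rule toeplitz_subshift_generated[OF assms(1)])
next
  assume "toeplitz_subshift A X"
  then show "\<exists>B \<tau>. directive_sequence B \<tau> \<and> constant_length_seq B \<tau> \<and> primitive_seq B \<tau> \<and>
      recognizable B \<tau> \<and> has_coincidences B \<tau> \<and> generates B \<tau> X"
    using toeplitz_subshift_generated[OF assms(1)] proper_coincidences by blast
next
  assume "\<exists>B \<tau>. directive_sequence B \<tau> \<and> constant_length_seq B \<tau> \<and> primitive_seq B \<tau> \<and>
      proper_seq B \<tau> \<and> recognizable B \<tau> \<and> generates B \<tau> X"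
  \<comment> \<open>Properness is traded for coincidences, so both converses rest on the same
    tower.\<close>
  then show "toeplitz_subshift A X"
    using coincidences_toeplitz_subshift[OF assms] proper_coincidences by blast
next
  assume "\<exists>B \<tau>. directive_sequence B \<tau> \<and> constant_length_seq B \<tau> \<and> primitive_seq B \<tau> \<and>
      recognizable B \<tau> \<and> has_coincidences B \<tau> \<and> generates B \<tau> X"
  then show "toeplitz_subshift A X"
    using coincidences_toeplitz_subshift[OF assms] by blast
qed

end
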